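(* The operators $\mathcal{G}_\ell=\sum_{E\in\mathfrak{G}_\ell}X(E)^2$, $\ell=1,\dots,7$, acting on $\mathbb{S}^7$, pairwise commute, and they commute with the sublaplacian $\Delta^{\mathrm{sub}}_{\mathrm{T},5}=-\sum_{j=1}^5X(A_j)^2$.
   Context: Let $A_1,\dots,A_7\in\mathfrak{so}(8)$ be a fixed family of real skew-symmetric $8\times 8$ matrices with $A_iA_j+A_jA_i=-2\delta_{ij}I$ for $i,j=1,\dots,7$. For $A=(a_{lk})\in\mathfrak{so}(8)$ let $X(A)=\sum_{l,k=1}^8a_{lk}x_k\frac{\partial}{\partial x_l}$, a linear vector field on $\mathbb{R}^8$ tangent to the unit sphere $\mathbb{S}^7$; its restriction to $\mathbb{S}^7$ is denoted by the same symbol and regarded as a first order differential operator on $C^\infty(\mathbb{S}^7)$. The generating sets are $\mathfrak{G}_\ell=\{A_iA_j : 1\le i<j\le\ell+1\}$ for $1\le\ell\le4$; $\mathfrak{G}_5=\{A_iA_j : 1\le i<j\le5 \text{ or } (i,j)=(6,7)\}$; $\mathfrak{G}_6=\mathfrak{G}_5\cup\{A_6,A_7\}$; $\mathfrak{G}_7=\{A_iA_j : 1\le i<j\le7\}\cup\{A_k : 1\le k\le7\}$. *)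

theory Defs
  imports "HOL-Analysis.Analysis"
begin

definition partial_deriv :: "'n::finite \<Rightarrow> (real^'n \<Rightarrow> real) \<Rightarrow> real^'n \<Rightarrow> real" where
  "partial_deriv l F x = frechet_derivative F (at x) (axis l 1)"

text \<open>Only meant for open \<open>U\<close>.\<close>

fun Ck_on :: "nat \<Rightarrow> (real^'n::finite) set \<Rightarrow> (real^'n \<Rightarrow> real) \<Rightarrow> bool" where
  "Ck_on 0 U F \<longleftrightarrow> continuous_on U F"
| "Ck_on (Suc k) U F \<longleftrightarrow>
     (\<forall>x\<in>U. F differentiable (at x)) \<and> (\<forall>l. Ck_on k U (partial_deriv l F))"

definition smooth_on_open :: "(real^'n::finite) set \<Rightarrow> (real^'n \<Rightarrow> real) \<Rightarrow> bool" where
  "smooth_on_open U F \<longleftrightarrow> open U \<and> (\<forall>k. Ck_on k U F)"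

abbreviation unit_sphere :: "(real^'n::finite) set" where
  "unit_sphere \<equiv> sphere 0 1"

text \<open>A function on the sphere is represented by a total function on the ambient space whose
  values off the sphere are irrelevant. It is smooth iff it is the restriction of a smooth function
  on an open neighbourhood of the sphere (the sphere being an embedded submanifold).\<close>

definition smooth_on_sphere :: "(real^'n::finite \<Rightarrow> real) \<Rightarrow> bool" where
  "smooth_on_sphere f \<longleftrightarrow>
     (\<exists>U F. unit_sphere \<subseteq> U \<and> smooth_on_open U F \<and> (\<forall>x\<in>unit_sphere. F x = f x))"

definition skew_symmetric :: "real^'n^'n \<Rightarrow> bool" where
  "skew_symmetric A \<longleftrightarrow> transpose A = - A"

definition linear_vf :: "real^'n^'n \<Rightarrow> (real^'n::finite \<Rightarrow> real) \<Rightarrow> real^'n \<Rightarrow> real" where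
  "linear_vf A F x = (\<Sum>l\<in>UNIV. \<Sum>k\<in>UNIV. A $ l $ k * x $ k * partial_deriv l F x)"

text \<open>The restriction of the vector field to the sphere acts on a function \<open>f\<close> on the sphere by
  applying the ambient field to an extension of \<open>f\<close>; here the extension that is constant along rays.
  For skew-symmetric \<open>A\<close> the field is tangent to the sphere and any other extension gives the same
  result, see \<open>sphere_vf_extension\<close> below.\<close>

definition sphere_vf :: "real^'n^'n \<Rightarrow> (real^'n::finite \<Rightarrow> real) \<Rightarrow> real^'n \<Rightarrow> real" where
  "sphere_vf A f x = linear_vf A (\<lambda>y. f (y /\<^sub>R norm y)) x"

lemma linear_vf_eq_derivative:
  assumes "(F has_derivative D) (at x)"
  shows "linear_vf A F x = D (A *v x)"
proof -
  have lin: "linear D" using assms has_derivative_linear by blast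
  have D: "frechet_derivative F (at x) = D"
    using assms frechet_derivative_at by metis
  have "D (A *v x) = D (\<Sum>l\<in>UNIV. (A *v x) $ l *\<^sub>R axis l 1)"
    using basis_expansion[of "A *v x"] by (simp add: scalar_mult_eq_scaleR)
  also have "\<dots> = (\<Sum>l\<in>UNIV. (A *v x) $ l * D (axis l 1))"
    by (simp add: linear_sum[OF lin] linear_scale[OF lin])
  finally show ?thesis
    by (simp add: linear_vf_def partial_deriv_def D matrix_vector_mult_def sum_distrib_right)
qed

lemma skew_symmetric_inner:
  assumes "skew_symmetric A"
  shows "x \<bullet> (A *v x) = 0"
proof -
  have "(- A) *v x = - (A *v x)"
    by (simp add: vec_eq_iff matrix_vector_mult_def sum_negf)
  moreover have "x \<bullet> (A *v x) = (transpose A *v x) \<bullet> x"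
    by (simp add: dot_lmul_matrix flip: vector_transpose_matrix)
  ultimately have "x \<bullet> (A *v x) = - (x \<bullet> (A *v x))"
    using assms unfolding skew_symmetric_def by (metis inner_commute inner_minus_right)
  then show ?thesis by simp
qed

lemma sphere_vf_extension:
  fixes A :: "real^'n::finite^'n"
  assumes A: "skew_symmetric A" and x: "x \<in> unit_sphere"
    and F: "F differentiable (at x)" and eq: "\<And>y. y \<in> unit_sphere \<Longrightarrow> F y = f y"
  shows "sphere_vf A f x = linear_vf A F x"
proof -
  have nx: "norm x = 1" and x0: "x \<noteq> 0" using x by auto
  obtain D where D: "(F has_derivative D) (at x)"
    using F unfolding differentiable_def by blast
  have lin: "linear D" using D has_derivative_linear by blast
  have r: "((\<lambda>y::real^'n. y /\<^sub>R norm y) has_derivative (\<lambda>h. h - (x \<bullet> h) *\<^sub>R x)) (at x)"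
    using nx x0 by (auto intro!: derivative_eq_intros has_derivative_norm
        simp: fun_eq_iff sgn_div_norm inner_commute)
  have "((\<lambda>y. F (y /\<^sub>R norm y)) has_derivative (\<lambda>h. D (h - (x \<bullet> h) *\<^sub>R x))) (at x)"
    using has_derivative_compose[OF r, of F D] D nx by simp
  then have "((\<lambda>y. f (y /\<^sub>R norm y)) has_derivative (\<lambda>h. D (h - (x \<bullet> h) *\<^sub>R x))) (at x)"
    by (rule has_derivative_transform_within_open[where s = "- {0}"]) (auto simp: x0 eq)
  then have "sphere_vf A f x = D (A *v x - (x \<bullet> (A *v x)) *\<^sub>R x)"
    unfolding sphere_vf_def by (rule linear_vf_eq_derivative)
  then show ?thesis
    by (simp add: skew_symmetric_inner[OF A] linear_vf_eq_derivative[OF D])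
qed

definition clifford_family :: "(nat \<Rightarrow> real^8^8) \<Rightarrow> bool" where
  "clifford_family A \<longleftrightarrow>
     (\<forall>i\<in>{1..7}. skew_symmetric (A i)) \<and>
     (\<forall>i\<in>{1..7}. \<forall>j\<in>{1..7}.
        A i ** A j + A j ** A i = (if i = j then - 2 else 0) *\<^sub>R mat 1)"

text \<open>Relevant only for \<open>l\<close> between 1 and 7.\<close>

definition generating_set :: "(nat \<Rightarrow> real^8^8) \<Rightarrow> nat \<Rightarrow> (real^8^8) set" where
  "generating_set A l =
     (let G5 = {A i ** A j | i j. (1 \<le> i \<and> i < j \<and> j \<le> 5) \<or> (i, j) = (6, 7)}
      in if l \<le> 4 then {A i ** A j | i j. 1 \<le> i \<and> i < j \<and> j \<le> l + 1}
         else if l = 5 then G5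
         else if l = 6 then G5 \<union> {A 6, A 7}
         else {A i ** A j | i j. 1 \<le> i \<and> i < j \<and> j \<le> 7} \<union> {A k | k. 1 \<le> k \<and> k \<le> 7})"

definition op_G :: "(nat \<Rightarrow> real^8^8) \<Rightarrow> nat \<Rightarrow> (real^8 \<Rightarrow> real) \<Rightarrow> real^8 \<Rightarrow> real" where
  "op_G A l f x = (\<Sum>E\<in>generating_set A l. sphere_vf E (sphere_vf E f) x)"

definition sublaplacian_T5 :: "(nat \<Rightarrow> real^8^8) \<Rightarrow> (real^8 \<Rightarrow> real) \<Rightarrow> real^8 \<Rightarrow> real" where
  "sublaplacian_T5 A f x = - (\<Sum>j\<in>{1..5}. sphere_vf (A j) (sphere_vf (A j) f) x)"

definition commute_on_sphere ::
    "((real^'n::finite \<Rightarrow> real) \<Rightarrow> real^'n \<Rightarrow> real) \<Rightarrow>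
     ((real^'n \<Rightarrow> real) \<Rightarrow> real^'n \<Rightarrow> real) \<Rightarrow> bool" where
  "commute_on_sphere P Q \<longleftrightarrow>
     (\<forall>f. smooth_on_sphere f \<longrightarrow> (\<forall>x\<in>unit_sphere. P (Q f) x = Q (P f) x))"

end

theory Submission
  imports Defs
begin

text \<open>With \<open>A\<^sub>0 = I\<close>, the matrices \<open>A\<^sub>k\<close> and \<open>A\<^sub>i A\<^sub>j\<close> become the standard basis of \<open>so(8)\<close> indexed by
  the pairs from \<open>{0, \<dots>, 7}\<close>. The sum \<open>C\<^sub>I\<close> of squares over the pairs from \<open>I\<close> is a Casimir operator, so \<open>C\<^sub>I\<close> and
  \<open>C\<^sub>J\<close> commute whenever \<open>I\<close> and \<open>J\<close> are nested or disjoint. Each \<open>\<G>\<^sub>l\<close> is a combination of such operators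
  for the laminar family \<open>{1, \<dots>, n}\<close> (\<open>n \<le> 5\<close>), \<open>{6, 7}\<close>, \<open>{0, 6, 7}\<close>, \<open>{0, \<dots>, 7}\<close>. For the
  sublaplacian one needs a relation outside the enveloping algebra: the vectors \<open>A\<^sub>k x\<close>, \<open>k = 0, \<dots>, 7\<close>, are
  orthogonal of length \<open>|x|\<close>, hence the sum of all seven \<open>X(A\<^sub>k)\<^sup>2\<close> is a multiple of the full Casimir
  operator, and subtracting \<open>X(A\<^sub>6)\<^sup>2 + X(A\<^sub>7)\<^sup>2\<close> leaves a combination for the same laminar
  family.\<close>

subsection \<open>Smooth functions and Hessians\<close>

lemma partial_deriv_eqI:
  assumes "(F has_derivative D) (at x)"
  shows "partial_deriv l F x = D (axis l 1)"
  using frechet_derivative_at[OF assms] by (simp add: partial_deriv_def)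

lemma has_derivative_partial_deriv:
  assumes "F differentiable (at x)"
  shows "(F has_derivative (\<lambda>h. \<Sum>l\<in>UNIV. h $ l * partial_deriv l F x)) (at x)"
proof -
  obtain D where D: "(F has_derivative D) (at x)"
    using assms unfolding differentiable_def by blast
  have "D h = (\<Sum>l\<in>UNIV. h $ l * partial_deriv l F x)" for h
  proof -
    have "D h = D (\<Sum>l\<in>UNIV. h $ l *\<^sub>R axis l 1)"
      using basis_expansion[of h] by (simp add: scalar_mult_eq_scaleR)
    also have "\<dots> = (\<Sum>l\<in>UNIV. h $ l * D (axis l 1))"
      using has_derivative_linear[OF D] by (simp add: linear_sum linear_scale)
    finally show ?thesis by (simp add: partial_deriv_eqI[OF D])
  qed
  then show ?thesis using D by presburger
qed

lemma linear_vf_partial_deriv: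
  "linear_vf E F x = (\<Sum>l\<in>UNIV. (E *v x) $ l * partial_deriv l F x)"
  by (simp add: linear_vf_def matrix_vector_mult_def sum_distrib_right)

section \<open>Symmetry of second partial derivatives\<close>

lemma has_real_derivative_partial_deriv:
  assumes "F differentiable (at (v + s *\<^sub>R axis i 1))"
  shows "((\<lambda>s. F (v + s *\<^sub>R axis i 1)) has_real_derivative
           partial_deriv i F (v + s *\<^sub>R axis i 1)) (at s)"
proof -
  have "((\<lambda>s. v + s *\<^sub>R axis i 1) has_derivative (\<lambda>h. h *\<^sub>R axis i 1)) (at s)"
    by (auto intro!: derivative_eq_intros)
  from has_derivative_compose[OF this has_derivative_partial_deriv[OF assms]]
  have "((\<lambda>s. F (v + s *\<^sub>R axis i 1)) has_derivative
      (\<lambda>h. h * partial_deriv i F (v + s *\<^sub>R axis i 1))) (at s)"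
    by (simp add: axis_def if_distrib[of "\<lambda>c. _ * c"] if_distrib[of "\<lambda>c. c * _"] cong: if_cong)
  then show ?thesis
    unfolding has_field_derivative_def by (rule has_derivative_eq_rhs) (simp add: fun_eq_iff)
qed

text \<open>The mean value theorem is applied twice: first in the direction \<open>i\<close> to the
  difference of \<open>F\<close> along two parallel edges, then in the direction \<open>j\<close> to
  \<open>partial_deriv i F\<close>. The second difference itself is symmetric in \<open>i\<close>
  and \<open>j\<close>, which \<open>partial_deriv_commute\<close> exploits.\<close>

lemma second_difference_mvt:
  fixes F :: "real^'n::finite \<Rightarrow> real"
  assumes F: "\<And>y. y \<in> ball x r \<Longrightarrow> F differentiable (at y)"
    and dF: "\<And>y. y \<in> ball x r \<Longrightarrow> partial_deriv i F differentiable (at y)"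
    and h: "0 < h" "2 * h < r"
  obtains y where "dist x y \<le> 2 * h"
    "F (x + h *\<^sub>R axis i 1 + h *\<^sub>R axis j 1) - F (x + h *\<^sub>R axis i 1) - F (x + h *\<^sub>R axis j 1) + F x
       = h\<^sup>2 * partial_deriv j (partial_deriv i F) y"
proof -
  let ?p = "\<lambda>s t. x + s *\<^sub>R axis i 1 + t *\<^sub>R axis j (1::real)"
  have near: "dist x (?p s t) \<le> 2 * h" if "0 \<le> s" "s \<le> h" "0 \<le> t" "t \<le> h" for s t
  proof -
    have "norm (s *\<^sub>R axis i 1 + t *\<^sub>R axis j (1::real)) \<le> s + t"
      using norm_triangle_ineq[of "s *\<^sub>R axis i 1" "t *\<^sub>R axis j (1::real)"] that by simp
    then show ?thesis using that by (simp add: dist_norm norm_minus_commute add.assoc add.commute)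
  qed
  then have ball: "?p s t \<in> ball x r" if "0 \<le> s" "s \<le> h" "0 \<le> t" "t \<le> h" for s t
    using that h by (smt (verit) mem_ball)
  have d1: "((\<lambda>s. F (?p s t)) has_real_derivative partial_deriv i F (?p s t)) (at s)"
    if "0 \<le> s" "s \<le> h" "0 \<le> t" "t \<le> h" for s t
    using has_real_derivative_partial_deriv[of F "x + t *\<^sub>R axis j 1" s i] F[OF ball[OF that]]
    by (simp add: algebra_simps)
  have "\<exists>\<xi>>0. \<xi> < h \<and> (F (?p h h) - F (?p h 0)) - (F (?p 0 h) - F (?p 0 0)) =
      (h - 0) * (partial_deriv i F (?p \<xi> h) - partial_deriv i F (?p \<xi> 0))"
    using h by (intro MVT2 DERIV_diff d1) auto
  then obtain \<xi> where \<xi>: "0 < \<xi>" "\<xi> < h" and e1: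
      "(F (?p h h) - F (?p h 0)) - (F (?p 0 h) - F (?p 0 0)) =
      h * (partial_deriv i F (?p \<xi> h) - partial_deriv i F (?p \<xi> 0))"
    by auto
  have "\<exists>\<eta>>0. \<eta> < h \<and> partial_deriv i F (?p \<xi> h) - partial_deriv i F (?p \<xi> 0) =
      (h - 0) * partial_deriv j (partial_deriv i F) (?p \<xi> \<eta>)"
    using h \<xi> by (intro MVT2 has_real_derivative_partial_deriv dF ball) auto
  then obtain \<eta> where \<eta>: "0 < \<eta>" "\<eta> < h" and e2:
      "partial_deriv i F (?p \<xi> h) - partial_deriv i F (?p \<xi> 0) =
       h * partial_deriv j (partial_deriv i F) (?p \<xi> \<eta>)"
    by auto
  show ?thesis
    using near[of \<xi> \<eta>] \<xi> \<eta> e1 e2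
    by (intro that[of "?p \<xi> \<eta>"]) (auto simp: power2_eq_square algebra_simps)
qed

text \<open>The same second difference equals \<open>h\<^sup>2\<close> times either mixed
  derivative, each at some point within \<open>2 * h\<close> of \<open>x\<close>. Continuity of both
  at \<open>x\<close> then excludes different values there.\<close>

lemma partial_deriv_commute:
  fixes F :: "real^'n::finite \<Rightarrow> real"
  assumes U: "open U" "x \<in> U" and C2: "Ck_on 2 U F"
  shows "partial_deriv i (partial_deriv j F) x = partial_deriv j (partial_deriv i F) x"
proof (rule ccontr)
  let ?f = "partial_deriv i (partial_deriv j F)" and ?g = "partial_deriv j (partial_deriv i F)"
  assume ne: "?f x \<noteq> ?g x"
  define e where "e = \<bar>?f x - ?g x\<bar> / 2"
  have e: "e > 0" using ne by (simp add: e_def)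
  have dF: "F differentiable (at y)" "partial_deriv l F differentiable (at y)"
    "continuous_on U (partial_deriv k (partial_deriv l F))" if "y \<in> U" for y k l
    using C2 that by (auto simp: numeral_2_eq_2)
  obtain r where r: "r > 0" "ball x r \<subseteq> U" using U openE by blast
  have "isCont ?f x" "isCont ?g x"
    using dF(3)[OF U(2)] U by (auto simp: continuous_on_eq_continuous_at)
  then obtain d1 d2 where d: "d1 > 0" "d2 > 0"
     and f: "\<And>y. dist y x < d1 \<Longrightarrow> dist (?f y) (?f x) < e"
     and g: "\<And>y. dist y x < d2 \<Longrightarrow> dist (?g y) (?g x) < e"
    using e unfolding continuous_at_eps_delta by metis
  \<comment> \<open>A third of the radii leaves room for the distance \<open>2 * h\<close> of the
    intermediate points.\<close>
  define h where "h = min r (min d1 d2) / 3"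
  have h: "0 < h" "2 * h < r" "2 * h < d1" "2 * h < d2" using r d by (auto simp: h_def)
  obtain y where y: "dist x y \<le> 2 * h" and ye:
    "F (x + h *\<^sub>R axis j 1 + h *\<^sub>R axis i 1) - F (x + h *\<^sub>R axis j 1) - F (x + h *\<^sub>R axis i 1) + F x
       = h\<^sup>2 * ?f y"
    by (rule second_difference_mvt[of x r F j h i]) (use dF r h in auto)
  obtain z where z: "dist x z \<le> 2 * h" and ze:
    "F (x + h *\<^sub>R axis i 1 + h *\<^sub>R axis j 1) - F (x + h *\<^sub>R axis i 1) - F (x + h *\<^sub>R axis j 1) + F x
       = h\<^sup>2 * ?g z"
    by (rule second_difference_mvt[of x r F i h j]) (use dF r h in auto)
  have "x + h *\<^sub>R axis i 1 + h *\<^sub>R axis j 1 = x + h *\<^sub>R axis j 1 + h *\<^sub>R axis i 1"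
    by (simp add: algebra_simps)
  then have "h\<^sup>2 * ?f y = h\<^sup>2 * ?g z" using ye ze by (simp add: algebra_simps)
  then have "?f y = ?g z" using h(1) by simp
  moreover have "dist (?f y) (?f x) < e" "dist (?g z) (?g x) < e"
    using f[of y] g[of z] y z h by (auto simp: dist_commute)
  ultimately show False unfolding e_def dist_real_def by (smt (verit) field_sum_of_halves)
qed

section \<open>Locality and closure properties of C^k functions\<close>

lemma partial_deriv_cong:
  assumes "open U" "x \<in> U" "\<And>y. y \<in> U \<Longrightarrow> F y = G y"
  shows "partial_deriv l F x = partial_deriv l G x"
proof -
  have "(F has_derivative D) (at x) \<longleftrightarrow> (G has_derivative D) (at x)" for D
    using has_derivative_transform_within_open[of F D x UNIV, OF _ assms]
      has_derivative_transform_within_open[of G D x UNIV, OF _ assms(1,2) assms(3)[symmetric]]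
    by blast
  then show ?thesis by (simp add: partial_deriv_def frechet_derivative_def)
qed

lemma differentiable_transform_open:
  assumes "open U" "x \<in> U" "\<And>y. y \<in> U \<Longrightarrow> F y = G y" "F differentiable (at x)"
  shows "G differentiable (at x)"
proof -
  obtain D where "(F has_derivative D) (at x)"
    using assms(4) unfolding differentiable_def ..
  from has_derivative_transform_within_open[OF this assms(1-3)] show ?thesis
    unfolding differentiable_def by blast
qed

lemma Ck_on_cong:
  assumes "open U" "\<And>y. y \<in> U \<Longrightarrow> F y = G y"
  shows "Ck_on k U F \<longleftrightarrow> Ck_on k U G"
  using assms(2)
proof (induction k arbitrary: F G)
  case 0
  then show ?case by (simp cong: continuous_on_cong)
next
  case (Suc k)
  have "F differentiable (at x) \<longleftrightarrow> G differentiable (at x)" if "x \<in> U" for x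
    using differentiable_transform_open[of U x F G, OF assms(1) that Suc.prems]
      differentiable_transform_open[of U x G F, OF assms(1) that Suc.prems[symmetric]] by blast
  moreover have "Ck_on k U (partial_deriv l F) \<longleftrightarrow> Ck_on k U (partial_deriv l G)" for l
    by (rule Suc.IH) (rule partial_deriv_cong[OF assms(1) _ Suc.prems])
  ultimately show ?case by auto
qed

lemma Ck_on_Suc_imp: "Ck_on (Suc k) U F \<Longrightarrow> Ck_on k U F"
proof (induction k arbitrary: F)
  case 0
  then show ?case
    by (auto intro!: continuous_at_imp_continuous_on differentiable_imp_continuous_within)
next
  case (Suc k)
  then show ?case by (metis Ck_on.simps(2))
qed

lemma Ck_on_const: "open U \<Longrightarrow> Ck_on k U (\<lambda>x. c)"
proof (induction k arbitrary: c)
  case (Suc k)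
  have "partial_deriv l (\<lambda>x. c) = (\<lambda>x. 0)" for l :: 'a
    by (rule ext, subst partial_deriv_eqI[OF has_derivative_const]) simp
  with Suc show ?case by simp
qed simp

lemma Ck_on_lincomb:
  assumes "open U"
  shows "Ck_on k U F \<Longrightarrow> Ck_on k U G \<Longrightarrow> Ck_on k U (\<lambda>x. c * F x + d * G x)"
proof (induction k arbitrary: F G)
  case 0
  then show ?case by (auto intro!: continuous_intros)
next
  case (Suc k)
  have "Ck_on k U (partial_deriv l (\<lambda>x. c * F x + d * G x))" for l
  proof -
    have "partial_deriv l (\<lambda>x. c * F x + d * G x) x = c * partial_deriv l F x + d * partial_deriv l G x"
      if "x \<in> U" for x
    proof -
      have "(F has_derivative frechet_derivative F (at x)) (at x)"
           "(G has_derivative frechet_derivative G (at x)) (at x)"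
        using Suc.prems that by (auto simp: frechet_derivative_works)
      then have "((\<lambda>x. c * F x + d * G x) has_derivative
          (\<lambda>h. c * frechet_derivative F (at x) h + d * frechet_derivative G (at x) h)) (at x)"
        by (auto intro!: derivative_eq_intros)
      then show ?thesis by (subst partial_deriv_eqI) (auto simp: partial_deriv_def)
    qed
    moreover have "Ck_on k U (\<lambda>x. c * partial_deriv l F x + d * partial_deriv l G x)"
      using Suc by auto
    ultimately show ?thesis
      by (rule Ck_on_cong[OF assms, THEN iffD2])
  qed
  moreover have "(\<lambda>x. c * F x + d * G x) differentiable (at x)" if "x \<in> U" for x
    using Suc.prems that by (auto intro!: derivative_intros)
  ultimately show ?case by simp
qed

text \<open>The coefficients of a linear vector field are linear in the coordinates, so this case of
  the product rule together with \<open>Ck_on_lincomb\<close> covers them.\<close>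

lemma Ck_on_coord_mult:
  assumes "open U"
  shows "Ck_on k U F \<Longrightarrow> Ck_on k U (\<lambda>x. x $ i * F x)"
proof (induction k arbitrary: F)
  case 0
  then show ?case by (auto intro!: continuous_intros)
next
  case (Suc k)
  have der: "((\<lambda>x. x $ i * F x) has_derivative
          (\<lambda>h. x $ i * frechet_derivative F (at x) h + h $ i * F x)) (at x)" if "x \<in> U" for x
  proof -
    have "(F has_derivative frechet_derivative F (at x)) (at x)"
      using Suc.prems that by (auto simp: frechet_derivative_works)
    moreover have "((\<lambda>x::real^'a. x $ i) has_derivative (\<lambda>h. h $ i)) (at x)"
      by (rule bounded_linear_imp_has_derivative) (rule bounded_linear_vec_nth)
    ultimately show ?thesis
      by (auto intro!: derivative_eq_intros)
  qed
  have "Ck_on k U (partial_deriv l (\<lambda>x. x $ i * F x))" for l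
  proof -
    \<comment> \<open>The factor \<open>1 *\<close> brings the product rule into the shape of
      \<open>Ck_on_lincomb\<close>. Its second term involves \<open>F\<close> itself, whose
      regularity drops from \<open>Suc k\<close> to \<open>k\<close> by
      \<open>Ck_on_Suc_imp\<close>.\<close>
    have "partial_deriv l (\<lambda>x. x $ i * F x) x
        = 1 * (x $ i * partial_deriv l F x) + (if l = i then 1 else 0) * F x"
      if "x \<in> U" for x
      by (subst partial_deriv_eqI[OF der[OF that]]) (simp add: partial_deriv_def axis_def)
    moreover have "Ck_on k U
        (\<lambda>x. 1 * (x $ i * partial_deriv l F x) + (if l = i then 1 else 0) * F x)"
      using Suc.prems Ck_on_Suc_imp[OF Suc.prems] by (intro Ck_on_lincomb assms Suc.IH) auto
    ultimately show ?thesis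
      by (rule Ck_on_cong[OF assms, THEN iffD2])
  qed
  moreover have "(\<lambda>x. x $ i * F x) differentiable (at x)" if "x \<in> U" for x
    using der[OF that] by (auto simp: differentiable_def)
  ultimately show ?case by simp
qed

lemma Ck_on_sum:
  assumes "open U" "finite K" "\<And>a. a \<in> K \<Longrightarrow> Ck_on k U (F a)"
  shows "Ck_on k U (\<lambda>x. \<Sum>a\<in>K. F a x)"
  using assms(2,3)
proof (induction K rule: finite_induct)
  case empty
  then show ?case using Ck_on_const[OF assms(1)] by simp
next
  case (insert a K)
  have "Ck_on k U (\<lambda>x. 1 * F a x + 1 * (\<Sum>a\<in>K. F a x))"
    by (rule Ck_on_lincomb[OF assms(1)]) (simp_all add: insert)
  then show ?case using insert.hyps by simp
qed

lemma Ck_on_linear_vf: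
  assumes "open U" "Ck_on (Suc k) U F"
  shows "Ck_on k U (linear_vf E F)"
proof -
  have "Ck_on k U (\<lambda>x. E $ l $ m * (x $ m * partial_deriv l F x))" for l m
    using Ck_on_lincomb[OF assms(1) Ck_on_coord_mult[OF assms(1)] Ck_on_const[OF assms(1)],
        of k "partial_deriv l F" "E $ l $ m" m 0 0] assms(2) by simp
  then have "Ck_on k U (\<lambda>x. \<Sum>l\<in>UNIV. \<Sum>m\<in>UNIV. E $ l $ m * (x $ m * partial_deriv l F x))"
    by (intro Ck_on_sum[OF assms(1)] finite)
  then show ?thesis unfolding linear_vf_def[abs_def] mult.assoc .
qed

section \<open>Second order part of a composition of linear vector fields\<close>

definition hess :: "(real^'n::finite \<Rightarrow> real) \<Rightarrow> real^'n \<Rightarrow> real^'n \<Rightarrow> real^'n \<Rightarrow> real" where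
  "hess F x u v = (\<Sum>p\<in>UNIV. \<Sum>q\<in>UNIV. u $ p * v $ q * partial_deriv q (partial_deriv p F) x)"

text \<open>Product rule: differentiating the coefficient \<open>B *v y\<close> in the direction
  \<open>A *v x\<close> gives \<open>B *v (A *v x)\<close>. Hence the matrix product appears in
  reversed order.\<close>

lemma linear_vf_linear_vf:
  assumes U: "open U" "x \<in> U" and C2: "Ck_on 2 U F"
  shows "linear_vf A (linear_vf B F) x = linear_vf (B ** A) F x + hess F x (B *v x) (A *v x)"
proof -
  let ?D = "\<lambda>p h. \<Sum>q\<in>UNIV. h $ q * partial_deriv q (partial_deriv p F) x"
  have "(partial_deriv p F has_derivative ?D p) (at x)" for p
    using C2 U by (intro has_derivative_partial_deriv) (auto simp: numeral_2_eq_2)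
  moreover have "((\<lambda>y. (B *v y) $ p) has_derivative (\<lambda>h. (B *v h) $ p)) (at x)" for p
    by (rule bounded_linear_imp_has_derivative)
       (intro bounded_linear_compose[OF bounded_linear_vec_nth] matrix_vector_mul_bounded_linear)
  ultimately have "((\<lambda>y. \<Sum>p\<in>UNIV. (B *v y) $ p * partial_deriv p F y) has_derivative
     (\<lambda>h. \<Sum>p\<in>UNIV. (B *v x) $ p * ?D p h + (B *v h) $ p * partial_deriv p F x)) (at x)"
    by (auto intro!: derivative_eq_intros)
  then have "(linear_vf B F has_derivative
     (\<lambda>h. \<Sum>p\<in>UNIV. (B *v x) $ p * ?D p h + (B *v h) $ p * partial_deriv p F x)) (at x)"
    by (simp add: linear_vf_partial_deriv[abs_def])
  from linear_vf_eq_derivative[OF this, of A] show ?thesis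
    by (simp add: hess_def linear_vf_partial_deriv sum.distrib sum_distrib_left mult.assoc
        matrix_vector_mul_assoc)
qed

lemma hess_commute:
  assumes "open U" "x \<in> U" "Ck_on 2 U F"
  shows "hess F x u v = hess F x v u"
  unfolding hess_def
  by (subst sum.swap) (simp add: mult.commute mult.left_commute partial_deriv_commute[OF assms])

subsection \<open>Commuting linear operators\<close>

text \<open>Linearity is asked for on \<open>V\<close> only, since differentiation is linear only on
  differentiable functions. One identity in \<open>c\<close> and \<open>d\<close> encodes additivity
  and homogeneity.\<close>

definition linear_op :: "('a \<Rightarrow> real) set \<Rightarrow> (('a \<Rightarrow> real) \<Rightarrow> 'a \<Rightarrow> real) \<Rightarrow> bool" where
  "linear_op V S \<longleftrightarrow> (\<forall>F\<in>V. S F \<in> V) \<and>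
     (\<forall>F\<in>V. \<forall>G\<in>V. \<forall>c d. S (\<lambda>x. c * F x + d * G x) = (\<lambda>x. c * S F x + d * S G x))"

definition commuting :: "('a \<Rightarrow> real) set \<Rightarrow> (('a \<Rightarrow> real) \<Rightarrow> 'a \<Rightarrow> real) \<Rightarrow>
    (('a \<Rightarrow> real) \<Rightarrow> 'a \<Rightarrow> real) \<Rightarrow> bool" where
  "commuting V S T \<longleftrightarrow> (\<forall>F\<in>V. S (T F) = T (S F))"

lemma linear_op_closed: "linear_op V S \<Longrightarrow> F \<in> V \<Longrightarrow> S F \<in> V"
  by (simp add: linear_op_def)

lemma linear_op_lincomb:
  "linear_op V S \<Longrightarrow> F \<in> V \<Longrightarrow> G \<in> V \<Longrightarrow>
    S (\<lambda>x. c * F x + d * G x) = (\<lambda>x. c * S F x + d * S G x)"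
  by (simp add: linear_op_def)

lemma linear_op_comp: "linear_op V S \<Longrightarrow> linear_op V T \<Longrightarrow> linear_op V (\<lambda>F. S (T F))"
  by (simp add: linear_op_def)

lemma commuting_sym: "commuting V S T \<Longrightarrow> commuting V T S"
  by (simp add: commuting_def)

lemma commuting_comp:
  "linear_op V T1 \<Longrightarrow> linear_op V T2 \<Longrightarrow> commuting V S T1 \<Longrightarrow> commuting V S T2 \<Longrightarrow>
    commuting V S (\<lambda>F. T1 (T2 F))"
  by (simp add: commuting_def linear_op_def)

locale function_space =
  fixes V :: "('a \<Rightarrow> real) set"
  assumes zero_mem: "(\<lambda>x. 0) \<in> V"
    and lincomb_mem: "F \<in> V \<Longrightarrow> G \<in> V \<Longrightarrow> (\<lambda>x. c * F x + d * G x) \<in> V"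
begin

lemma sum_mem:
  assumes "finite K" "\<And>a. a \<in> K \<Longrightarrow> G a \<in> V"
  shows "(\<lambda>x. \<Sum>a\<in>K. G a x) \<in> V"
  using assms
proof (induction K rule: finite_induct)
  case empty
  then show ?case using zero_mem by simp
next
  case (insert a K)
  then show ?case using lincomb_mem[of "G a" "\<lambda>x. \<Sum>a\<in>K. G a x" 1 1] by simp
qed

lemma linear_op_apply_sum:
  assumes S: "linear_op V S" and "finite K" "\<And>a. a \<in> K \<Longrightarrow> G a \<in> V"
  shows "S (\<lambda>x. \<Sum>a\<in>K. G a x) = (\<lambda>x. \<Sum>a\<in>K. S (G a) x)"
  using assms(2,3)
proof (induction K rule: finite_induct)
  case empty
  then show ?case using linear_op_lincomb[OF S zero_mem zero_mem, of 0 0] by simp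
next
  case (insert a K)
  then show ?case
    using linear_op_lincomb[OF S, of "G a" "\<lambda>x. \<Sum>a\<in>K. G a x" 1 1] sum_mem[of K G] by simp
qed

lemma linear_op_add_scaled:
  assumes "linear_op V S" "linear_op V T"
  shows "linear_op V (\<lambda>F x. a * S F x + b * T F x)"
  using assms lincomb_mem unfolding linear_op_def by (auto simp: algebra_simps)

lemma linear_op_sum:
  assumes "finite K" "\<And>a. a \<in> K \<Longrightarrow> linear_op V (T a)"
  shows "linear_op V (\<lambda>F x. \<Sum>a\<in>K. T a F x)"
  using assms unfolding linear_op_def
  by (auto simp: sum.distrib sum_distrib_left intro!: sum_mem)

lemma commuting_add_scaled:
  assumes "linear_op V S" "linear_op V T1" "linear_op V T2" "commuting V S T1" "commuting V S T2"
  shows "commuting V S (\<lambda>F x. a * T1 F x + b * T2 F x)"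
  using assms unfolding linear_op_def commuting_def by simp

lemma commuting_sum:
  assumes "linear_op V S" "finite K" "\<And>a. a \<in> K \<Longrightarrow> linear_op V (T a)"
    "\<And>a. a \<in> K \<Longrightarrow> commuting V S (T a)"
  shows "commuting V S (\<lambda>F x. \<Sum>a\<in>K. T a F x)"
  unfolding commuting_def
proof
  fix F assume F: "F \<in> V"
  have "S (\<lambda>x. \<Sum>a\<in>K. T a F x) = (\<lambda>x. \<Sum>a\<in>K. S (T a F) x)"
    using assms F by (intro linear_op_apply_sum) (auto intro: linear_op_closed)
  also have "\<dots> = (\<lambda>x. \<Sum>a\<in>K. T a (S F) x)"
    using assms(4) F by (auto simp: commuting_def)
  finally show "S (\<lambda>x. \<Sum>a\<in>K. T a F x) = (\<lambda>x. \<Sum>a\<in>K. T a (S F) x)" .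
qed

end

subsection \<open>Linear vector fields on smooth functions\<close>

text \<open>Cutting functions off outside \<open>U\<close> turns equality on \<open>U\<close> into equality of functions.\<close>

definition smooth_functions :: "(real^'n::finite) set \<Rightarrow> (real^'n \<Rightarrow> real) set" where
  "smooth_functions U = {F. (\<forall>k. Ck_on k U F) \<and> (\<forall>x. x \<notin> U \<longrightarrow> F x = 0)}"

definition vf :: "(real^'n::finite) set \<Rightarrow> real^'n^'n \<Rightarrow> (real^'n \<Rightarrow> real) \<Rightarrow> real^'n \<Rightarrow> real" where
  "vf U E F x = (if x \<in> U then linear_vf E F x else 0)"

lemma function_space_smooth: "open U \<Longrightarrow> function_space (smooth_functions U)"
  by unfold_locales (auto simp: smooth_functions_def Ck_on_const Ck_on_lincomb)

lemma smooth_functions_Ck: "F \<in> smooth_functions U \<Longrightarrow> Ck_on k U F"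
  by (simp add: smooth_functions_def)

lemma smooth_functions_differentiable:
  "F \<in> smooth_functions U \<Longrightarrow> x \<in> U \<Longrightarrow> F differentiable (at x)"
  using smooth_functions_Ck[of F U 1] by simp

lemma linear_op_vf:
  assumes "open U"
  shows "linear_op (smooth_functions U) (vf U E)"
proof -
  have "vf U E F \<in> smooth_functions U" if "F \<in> smooth_functions U" for F
  proof -
    have "Ck_on k U (vf U E F)" for k
      by (rule Ck_on_cong[OF assms, THEN iffD2, OF _ Ck_on_linear_vf[OF assms smooth_functions_Ck[OF that]]])
         (simp add: vf_def)
    then show ?thesis by (simp add: smooth_functions_def vf_def)
  qed
  moreover have "vf U E (\<lambda>x. c * F x + d * G x) = (\<lambda>x. c * vf U E F x + d * vf U E G x)"
    if "F \<in> smooth_functions U" "G \<in> smooth_functions U" for F G c d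
  proof
    fix x
    show "vf U E (\<lambda>x. c * F x + d * G x) x = c * vf U E F x + d * vf U E G x"
    proof (cases "x \<in> U")
      case True
      have "F differentiable (at x)" "G differentiable (at x)"
        using that True by (auto intro: smooth_functions_differentiable)
      then obtain D D' where D: "(F has_derivative D) (at x)" "(G has_derivative D') (at x)"
        unfolding differentiable_def by blast
      then have "((\<lambda>x. c * F x + d * G x) has_derivative (\<lambda>h. c * D h + d * D' h)) (at x)"
        by (intro has_derivative_add has_derivative_mult_right)
      with D show ?thesis
        using True by (simp add: vf_def linear_vf_eq_derivative)
    qed (simp add: vf_def)
  qed
  ultimately show ?thesis by (simp add: linear_op_def)
qed

lemma vf_vf:
  assumes "open U" "x \<in> U" "F \<in> smooth_functions U"
  shows "vf U A (vf U B F) x = linear_vf (B ** A) F x + hess F x (B *v x) (A *v x)"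
proof -
  \<comment> \<open>As \<open>U\<close> is open, the cut-off does not affect derivatives at points
    of \<open>U\<close>.\<close>
  have "partial_deriv l (vf U B F) x = partial_deriv l (linear_vf B F) x" for l
    by (rule partial_deriv_cong[OF assms(1,2)]) (simp add: vf_def)
  then have "vf U A (vf U B F) x = linear_vf A (linear_vf B F) x"
    using assms(2) by (simp add: vf_def linear_vf_partial_deriv)
  then show ?thesis
    by (simp add: linear_vf_linear_vf[OF assms(1,2) smooth_functions_Ck[OF assms(3)]])
qed

section \<open>Brackets and squares of linear vector fields\<close>

lemma linear_vf_linear:
  "linear_vf (c *\<^sub>R A + d *\<^sub>R B) F x = c * linear_vf A F x + d * linear_vf B F x"
  by (simp add: linear_vf_def sum.distrib sum_distrib_left algebra_simps)

lemma linear_vf_diff: "linear_vf (A - B) F x = linear_vf A F x - linear_vf B F x"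
  using linear_vf_linear[of 1 A "-1" B F x] by simp

lemma vf_linear:
  "vf U (c *\<^sub>R A + d *\<^sub>R B) F = (\<lambda>x. c * vf U A F x + d * vf U B F x)"
  by (auto simp: vf_def linear_vf_linear)

text \<open>By \<open>vf_vf\<close> both orders have Hessian terms that differ only by exchanging
  the arguments, so they cancel by symmetry. The remaining first order terms form a linear field,
  with reversed matrix products as in \<open>vf_vf\<close>.\<close>

lemma vf_bracket:
  assumes "open U" "F \<in> smooth_functions U"
  shows "vf U A (vf U B F) x = vf U B (vf U A F) x + vf U (B ** A - A ** B) F x"
proof (cases "x \<in> U")
  case True
  then show ?thesis
    using hess_commute[OF assms(1) True smooth_functions_Ck[OF assms(2)], of "A *v x" "B *v x"]
    by (simp add: vf_vf[OF assms(1) True assms(2)]) (simp add: True vf_def linear_vf_diff)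
qed (simp add: vf_def)

text \<open>This makes the signs between \<open>so8 A i j\<close>, \<open>so8 A j i\<close> and
  \<open>A i ** A j\<close> harmless in sums of squares.\<close>

lemma vf_square_minus:
  assumes "open U" "F \<in> smooth_functions U"
  shows "vf U (- E) (vf U (- E) F) = vf U E (vf U E F)"
proof -
  have *: "vf U (- E) G = (\<lambda>x. (-1) * vf U E G x + 0 * G x)" for G
    using vf_linear[of U "-1" E 0 E G] by simp
  show ?thesis
    unfolding * using linear_op_lincomb[OF linear_op_vf[OF assms(1)], of "vf U E F" F E "-1" 0]
      linear_op_closed[OF linear_op_vf[OF assms(1)] assms(2)] assms(2) by simp
qed

text \<open>The commutator is a derivation: \<open>[D, E E] = [D, E] E + E [D, E]\<close>, where
  \<open>[D, E]\<close> is the field of \<open>E ** D - D ** E\<close>.\<close>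

lemma vf_square_bracket:
  assumes "open U" "F \<in> smooth_functions U"
  shows "vf U D (vf U E (vf U E F)) x - vf U E (vf U E (vf U D F)) x =
    vf U (E ** D - D ** E) (vf U E F) x + vf U E (vf U (E ** D - D ** E) F) x"
proof -
  note lin = linear_op_vf[OF assms(1)]
  note cl = linear_op_closed[OF lin]
  have "vf U D (vf U E F) = (\<lambda>x. 1 * vf U E (vf U D F) x + 1 * vf U (E ** D - D ** E) F x)"
    using vf_bracket[OF assms, of D E] by (simp add: fun_eq_iff)
  then have "vf U E (vf U D (vf U E F)) x =
      vf U E (vf U E (vf U D F)) x + vf U E (vf U (E ** D - D ** E) F) x"
    by (simp add: linear_op_lincomb[OF lin cl[OF cl[OF assms(2)]] cl[OF assms(2)],
          where c = 1 and d = 1, simplified])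
  then show ?thesis
    using vf_bracket[OF assms(1) cl[OF assms(2)], of D E E x] by simp
qed

text \<open>This makes the symmetrised product of two fields an admissible \<open>S\<close> in
  \<open>sum_casimir_bracket\<close>.\<close>

lemma linear_anticommutator:
  assumes "open U" "F \<in> smooth_functions U"
  shows "linear (\<lambda>C. vf U C (vf U E F) x + vf U E (vf U C F) x)"
proof -
  note lin = linear_op_vf[OF assms(1)]
  note cl = linear_op_closed[OF lin]
  let ?S = "\<lambda>C. vf U C (vf U E F) x + vf U E (vf U C F) x"
  have *: "?S (c *\<^sub>R C + d *\<^sub>R D) = c * ?S C + d * ?S D" for c d C D
    by (simp add: vf_linear linear_op_lincomb[OF lin cl cl] assms(2) algebra_simps)
  show ?thesis
    by (rule linearI) (use *[of 1 _ 1] *[of _ _ 0] in \<open>simp_all add: algebra_simps\<close>)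
qed

text \<open>By \<open>vf_square_bracket\<close> the sum in \<open>zero\<close> is exactly the
  commutator with the sum of squares.\<close>

lemma commuting_vf_sum_squares:
  assumes U: "open U" and K: "finite K"
    and zero: "\<And>F x. F \<in> smooth_functions U \<Longrightarrow>
      (\<Sum>a\<in>K. vf U (E a ** D - D ** E a) (vf U (E a) F) x
            + vf U (E a) (vf U (E a ** D - D ** E a) F) x) = 0"
  shows "commuting (smooth_functions U) (vf U D) (\<lambda>F x. \<Sum>a\<in>K. vf U (E a) (vf U (E a) F) x)"
  unfolding commuting_def
proof (intro ballI ext)
  interpret function_space "smooth_functions U" by (rule function_space_smooth[OF U])
  fix F x assume F: "F \<in> smooth_functions U"
  note cl = linear_op_closed[OF linear_op_vf[OF U]]
  have "vf U D (\<lambda>x. \<Sum>a\<in>K. vf U (E a) (vf U (E a) F) x) x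
      - (\<Sum>a\<in>K. vf U (E a) (vf U (E a) (vf U D F)) x)
      = (\<Sum>a\<in>K. vf U D (vf U (E a) (vf U (E a) F)) x - vf U (E a) (vf U (E a) (vf U D F)) x)"
    by (subst linear_op_apply_sum[OF linear_op_vf[OF U] K cl[OF cl[OF F]]]) (simp add: sum_subtractf)
  also have "\<dots> = 0"
    unfolding vf_square_bracket[OF U F] by (rule zero[OF F])
  finally show "vf U D (\<lambda>x. \<Sum>a\<in>K. vf U (E a) (vf U (E a) F) x) x
      = (\<Sum>a\<in>K. vf U (E a) (vf U (E a) (vf U D F)) x)" by simp
qed

text \<open>With the symmetrised product for \<open>S\<close> this is the invariance of the quadratic Casimir element
  of the orthogonal Lie algebra on the index set \<open>I\<close>.\<close>

lemma sum_casimir_bracket: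
  fixes S :: "'m::real_vector \<Rightarrow> 'm \<Rightarrow> real" and B :: "'i \<Rightarrow> 'i \<Rightarrow> 'm"
  assumes lin: "\<And>E. linear (\<lambda>C. S C E)" and sym: "\<And>C E. S C E = S E C"
    and skew: "\<And>i j. i \<in> insert k (insert l I) \<Longrightarrow> j \<in> insert k (insert l I) \<Longrightarrow> B j i = - B i j"
    and br: "\<And>i j. i \<in> I \<Longrightarrow> j \<in> I \<Longrightarrow> br i j =
        (if j = k then 2 else 0) *\<^sub>R B i l - (if i = k then 2 else 0) *\<^sub>R B j l
      + (if i = l then 2 else 0) *\<^sub>R B j k - (if j = l then 2 else 0) *\<^sub>R B i k"
    and I: "finite I" "k \<in> I \<longleftrightarrow> l \<in> I"
  shows "(\<Sum>(i, j)\<in>I \<times> I. S (br i j) (B i j)) = 0"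
proof -
  have neg: "S C (- E) = - S C E" for C E
    using linear_neg[OF lin, of E C] by (simp add: sym[of C])
  have "S (br i j) (B i j) =
      (if j = k then 2 * S (B i l) (B i j) else 0) - (if i = k then 2 * S (B j l) (B i j) else 0)
    + (if i = l then 2 * S (B j k) (B i j) else 0) - (if j = l then 2 * S (B i k) (B i j) else 0)"
    if "i \<in> I" "j \<in> I" for i j
    by (simp add: br that linear_diff[OF lin] linear_add[OF lin] linear_scale[OF lin] linear_0[OF lin])
  then have "(\<Sum>(i, j)\<in>I \<times> I. S (br i j) (B i j)) =
      (\<Sum>i\<in>I. \<Sum>j\<in>I. (if j = k then 2 * S (B i l) (B i j) else 0))
    - (\<Sum>i\<in>I. \<Sum>j\<in>I. (if i = k then 2 * S (B j l) (B i j) else 0))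
    + (\<Sum>i\<in>I. \<Sum>j\<in>I. (if i = l then 2 * S (B j k) (B i j) else 0))
    - (\<Sum>i\<in>I. \<Sum>j\<in>I. (if j = l then 2 * S (B i k) (B i j) else 0))"
    by (simp add: sum.cartesian_product[symmetric] sum.distrib sum_subtractf)
  also have "(\<Sum>i\<in>I. \<Sum>j\<in>I. (if i = k then 2 * S (B j l) (B i j) else 0)) =
      (\<Sum>j\<in>I. \<Sum>i\<in>I. (if i = k then 2 * S (B j l) (B i j) else 0))"
    by (rule sum.swap)
  also have "(\<Sum>i\<in>I. \<Sum>j\<in>I. (if i = l then 2 * S (B j k) (B i j) else 0)) =
      (\<Sum>j\<in>I. \<Sum>i\<in>I. (if i = l then 2 * S (B j k) (B i j) else 0))"
    by (rule sum.swap)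
  also have "(\<Sum>i\<in>I. \<Sum>j\<in>I. (if j = k then 2 * S (B i l) (B i j) else 0))
    - (\<Sum>j\<in>I. \<Sum>i\<in>I. (if i = k then 2 * S (B j l) (B i j) else 0))
    + (\<Sum>j\<in>I. \<Sum>i\<in>I. (if i = l then 2 * S (B j k) (B i j) else 0))
    - (\<Sum>i\<in>I. \<Sum>j\<in>I. (if j = l then 2 * S (B i k) (B i j) else 0)) = 0"
  \<comment> \<open>If \<open>k\<close> and \<open>l\<close> lie in \<open>I\<close>, each delta
    collapses one sum. By skewness the first two terms give
    \<open>4 * (\<Sum>j\<in>I. S (B j l) (B j k))\<close>, and the last two give the negative of
    this with the arguments of \<open>S\<close> exchanged. If neither lies in \<open>I\<close>, all
    deltas vanish.\<close>
  proof (cases "k \<in> I")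
    case True
    then have l: "l \<in> I" using I by simp
    have "(\<Sum>j\<in>I. S (B j l) (B k j)) = (\<Sum>j\<in>I. - S (B j l) (B j k))"
      using skew[of _ k] True by (intro sum.cong) (simp_all add: neg)
    moreover have "(\<Sum>j\<in>I. S (B j k) (B l j)) = (\<Sum>j\<in>I. - S (B j k) (B j l))"
      using skew[of _ l] l by (intro sum.cong) (simp_all add: neg)
    moreover have "(\<Sum>j\<in>I. S (B j k) (B j l)) = (\<Sum>j\<in>I. S (B j l) (B j k))"
      by (intro sum.cong sym refl)
    ultimately show ?thesis
      using I True l by (simp add: sum_negf flip: sum_distrib_left)
  next
    case False
    then show ?thesis using I by (auto intro!: sum.neutral)
  qed
  finally show ?thesis .
qed

subsection \<open>The Clifford family as a basis of so(8)\<close>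

lemma matrix_mult_minus_left: "(- A) ** B = - (A ** (B :: real^'n^'m))" for A :: "real^'m^'k"
  by (simp add: matrix_matrix_mult_def vec_eq_iff sum_negf)

lemma matrix_mult_minus_right: "A ** (- B) = - (A ** (B :: real^'n^'m))" for A :: "real^'m^'k"
  by (simp add: matrix_matrix_mult_def vec_eq_iff sum_negf)

lemma matrix_mult_diff_left: "(A - A') ** B = A ** B - A' ** (B :: real^'n^'m)" for A A' :: "real^'m^'k"
  by (simp add: matrix_matrix_mult_def vec_eq_iff sum_subtractf algebra_simps)

lemma matrix_mult_diff_right: "A ** (B - B') = A ** B - A ** (B' :: real^'n^'m)" for A :: "real^'m^'k"
  by (simp add: matrix_matrix_mult_def vec_eq_iff sum_subtractf algebra_simps)

lemma matrix_mult_scaleR_left: "(c *\<^sub>R A) ** B = c *\<^sub>R (A ** (B :: real^'n^'m))" for A :: "real^'m^'k"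
  by (simp add: matrix_matrix_mult_def vec_eq_iff sum_distrib_left mult.assoc)

lemma matrix_mult_scaleR_right: "A ** (c *\<^sub>R B) = c *\<^sub>R (A ** (B :: real^'n^'m))" for A :: "real^'m^'k"
  by (simp add: matrix_matrix_mult_def vec_eq_iff sum_distrib_left mult.left_commute)

lemmas matrix_mult_bilinear = matrix_mult_minus_left matrix_mult_minus_right
  matrix_mult_diff_left matrix_mult_diff_right matrix_mult_scaleR_left matrix_mult_scaleR_right

abbreviation kdelta :: "nat \<Rightarrow> nat \<Rightarrow> real" where
  "kdelta i j \<equiv> (if i = j then 1 else 0)"

text \<open>Adjoining \<open>A 0 = mat 1\<close> makes \<open>A k\<close> and \<open>A i ** A j\<close> instances of one formula: \<open>so8 A 0 k\<close>
  is \<open>A k\<close>, and \<open>so8 A i j\<close> is \<open>- A i ** A j\<close> for distinct positive \<open>i\<close> and \<open>j\<close>. These 28 matrices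
  satisfy the relations of the standard basis of the Lie algebra \<open>so(8)\<close>.\<close>

definition cliff :: "(nat \<Rightarrow> real^8^8) \<Rightarrow> nat \<Rightarrow> real^8^8" where
  "cliff A i = (if i = 0 then mat 1 else A i)"

definition cliff_conj :: "(nat \<Rightarrow> real^8^8) \<Rightarrow> nat \<Rightarrow> real^8^8" where
  "cliff_conj A i = (if i = 0 then mat 1 else - A i)"

text \<open>\<open>cliff_conj A i\<close> is the transpose of \<open>cliff A i\<close>. Subtracting
  the identity for \<open>i = j\<close> makes the diagonal vanish, so that \<open>so8\<close> is
  skew in its indices without exception.\<close>

definition so8 :: "(nat \<Rightarrow> real^8^8) \<Rightarrow> nat \<Rightarrow> nat \<Rightarrow> real^8^8" where
  "so8 A i j = cliff_conj A i ** cliff A j - kdelta i j *\<^sub>R mat 1"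

lemma transpose_cliff:
  assumes "clifford_family A" "i \<le> 7"
  shows "transpose (cliff A i) = cliff_conj A i"
  using assms by (auto simp: cliff_def cliff_conj_def clifford_family_def skew_symmetric_def)

lemma clifford_anticommute:
  assumes "clifford_family A" "1 \<le> i" "i \<le> 7" "1 \<le> j" "j \<le> 7"
  shows "A i ** A j = (- 2 * kdelta i j) *\<^sub>R mat 1 - A j ** A i"
proof -
  have "A i ** A j + A j ** A i = (if i = j then - 2 else 0) *\<^sub>R mat 1"
    using assms by (auto simp: clifford_family_def)
  then show ?thesis by (simp add: algebra_simps split: if_splits)
qed

lemma clifford_square:
  assumes "clifford_family A" "1 \<le> i" "i \<le> 7"
  shows "A i ** A i = - mat 1"
proof -
  have "2 *\<^sub>R (A i ** A i) = 2 *\<^sub>R (- mat 1)"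
    using clifford_anticommute[OF assms assms(2,3)]
    by (simp add: scaleR_2 algebra_simps del: scaleR_cancel_left)
  then show ?thesis by (simp only: scaleR_cancel_left) simp
qed

text \<open>The identity commutes with every \<open>A j\<close>, so once it is adjoined the Clifford
  relation has to be stated for products of a conjugated and a plain factor: index pairs
  \<open>(0, j)\<close> and \<open>(j, 0)\<close> give \<open>A j\<close> and
  \<open>- A j\<close>.\<close>

lemma cliff_conj_cliff:
  assumes "clifford_family A" "i \<le> 7" "j \<le> 7"
  shows "cliff_conj A i ** cliff A j = (2 * kdelta i j) *\<^sub>R mat 1 - cliff_conj A j ** cliff A i"
  using clifford_anticommute[OF assms(1), of i j] assms(2,3)
  by (auto simp: cliff_def cliff_conj_def matrix_mult_bilinear scaleR_2 clifford_square[OF assms(1)])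

lemma cliff_cliff_conj:
  assumes "clifford_family A" "i \<le> 7" "j \<le> 7"
  shows "cliff A i ** cliff_conj A j = (2 * kdelta i j) *\<^sub>R mat 1 - cliff A j ** cliff_conj A i"
  using clifford_anticommute[OF assms(1), of i j] assms(2,3)
  by (auto simp: cliff_def cliff_conj_def matrix_mult_bilinear scaleR_2 clifford_square[OF assms(1)])

lemma cliff_conj_self:
  assumes "clifford_family A" "i \<le> 7"
  shows "cliff_conj A i ** cliff A i = mat 1" "cliff A i ** cliff_conj A i = mat 1"
  using clifford_square[OF assms(1), of i] assms
  by (auto simp: cliff_def cliff_conj_def matrix_mult_bilinear)

lemma so8_skew:
  assumes "clifford_family A" "i \<le> 7" "j \<le> 7"
  shows "so8 A j i = - so8 A i j"
  using cliff_conj_cliff[OF assms(1,3,2)] by (auto simp: so8_def scaleR_2)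

lemma so8_self: "clifford_family A \<Longrightarrow> i \<le> 7 \<Longrightarrow> so8 A i i = 0"
  by (simp add: so8_def cliff_conj_self)

text \<open>A product of two generators is a word of four factors, alternately conjugated and plain.
  Exchanging neighbouring indices costs a delta term, and both orders are brought to the common word
  \<open>?M k i ** ?M j l\<close>, which cancels in the bracket.\<close>

lemma so8_Lie_bracket:
  assumes A: "clifford_family A" and le: "i \<le> 7" "j \<le> 7" "k \<le> 7" "l \<le> 7"
  shows "so8 A i j ** so8 A k l - so8 A k l ** so8 A i j =
        (if j = k then 2 else 0) *\<^sub>R so8 A i l - (if i = k then 2 else 0) *\<^sub>R so8 A j l
      + (if i = l then 2 else 0) *\<^sub>R so8 A j k - (if j = l then 2 else 0) *\<^sub>R so8 A i k"
proof -
  let ?c = "cliff A" and ?d = "cliff_conj A"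
  let ?M = "\<lambda>i j. ?d i ** ?c j"
  note dc = cliff_conj_cliff[OF A] and cd = cliff_cliff_conj[OF A]
  have assoc: "?M a b ** ?M p q = ?d a ** (?c b ** ?d p) ** ?c q" for a b p q
    by (simp add: matrix_mul_assoc)
  have inner: "?M a b ** ?M p q = (2 * kdelta b p) *\<^sub>R ?M a q - ?M a p ** ?M b q"
    if "a \<le> 7" "b \<le> 7" "p \<le> 7" "q \<le> 7" for a b p q
    unfolding assoc cd[OF that(2,3)] by (simp add: matrix_mult_bilinear matrix_mul_assoc)
  have outer: "?M a b ** ?M p q = (2 * kdelta a b) *\<^sub>R ?M p q - ?M b a ** ?M p q"
    if "a \<le> 7" "b \<le> 7" for a b p q
    by (subst dc[OF that]) (simp add: matrix_mult_bilinear)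
  have outer': "?M a b ** ?M p q = (2 * kdelta p q) *\<^sub>R ?M a b - ?M a b ** ?M q p"
    if "p \<le> 7" "q \<le> 7" for a b p q
    by (subst dc[OF that]) (simp add: matrix_mult_bilinear)
  have e1: "?M i j ** ?M k l = (2 * kdelta j k) *\<^sub>R ?M i l - (2 * kdelta i k) *\<^sub>R ?M j l + ?M k i ** ?M j l"
    using inner[of i j k l] outer[of i k j l] le by simp
  have e2: "?M k l ** ?M i j = (2 * kdelta i l) *\<^sub>R ?M k j - (2 * kdelta j l) *\<^sub>R ?M k i + ?M k i ** ?M j l"
    using inner[of k l i j] outer'[of l j k i] le by (simp add: eq_commute)
  have "?M i j ** ?M k l - ?M k l ** ?M i j =
      (2 * kdelta j k) *\<^sub>R ?M i l - (2 * kdelta i k) *\<^sub>R ?M j l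
    - (2 * kdelta i l) *\<^sub>R ?M k j + (2 * kdelta j l) *\<^sub>R ?M k i"
    unfolding e1 e2 by simp
  moreover have "so8 A i j ** so8 A k l - so8 A k l ** so8 A i j = ?M i j ** ?M k l - ?M k l ** ?M i j"
    by (simp add: so8_def matrix_mult_bilinear)
  moreover have "?M k j = (2 * kdelta j k) *\<^sub>R mat 1 - ?M j k" "?M k i = (2 * kdelta i k) *\<^sub>R mat 1 - ?M i k"
    using dc[of k j] dc[of k i] le by (simp_all add: eq_commute)
  ultimately have "so8 A i j ** so8 A k l - so8 A k l ** so8 A i j =
      (2 * kdelta j k) *\<^sub>R ?M i l - (2 * kdelta i k) *\<^sub>R ?M j l
    - (2 * kdelta i l) *\<^sub>R ((2 * kdelta j k) *\<^sub>R mat 1 - ?M j k)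
    + (2 * kdelta j l) *\<^sub>R ((2 * kdelta i k) *\<^sub>R mat 1 - ?M i k)"
    by (simp only:)
  \<comment> \<open>Passing from \<open>?M\<close> to \<open>so8\<close> creates multiples of the
    identity, which cancel in pairs.\<close>
  also have "\<dots> = (2 * kdelta j k) *\<^sub>R so8 A i l - (2 * kdelta i k) *\<^sub>R so8 A j l
    + (2 * kdelta i l) *\<^sub>R so8 A j k - (2 * kdelta j l) *\<^sub>R so8 A i k"
    unfolding so8_def by (simp add: vec_eq_iff algebra_simps)
  moreover have "2 * (if P then 1 else 0) = (if P then 2 else 0 :: real)" for P
    by simp
  ultimately show ?thesis
    by (simp only:)
qed

text \<open>Reversing the indices of one factor costs a sign and makes the inner pair and then the
  outer pair collapse to the identity.\<close>

lemma so8_square: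
  assumes A: "clifford_family A" and le: "i \<le> 7" "j \<le> 7" "i \<noteq> j"
  shows "so8 A i j ** so8 A i j = - mat 1"
proof -
  have "so8 A i j ** so8 A i j = - ((cliff_conj A i ** cliff A j) ** (cliff_conj A j ** cliff A i))"
    using cliff_conj_cliff[OF A le(1,2)] le(3) by (simp add: so8_def matrix_mult_bilinear)
  also have "(cliff_conj A i ** cliff A j) ** (cliff_conj A j ** cliff A i)
      = cliff_conj A i ** (cliff A j ** cliff_conj A j) ** cliff A i"
    by (simp add: matrix_mul_assoc)
  finally show ?thesis
    by (simp add: cliff_conj_self[OF A] le)
qed

lemma skew_symmetric_so8:
  assumes "clifford_family A" "i \<le> 7" "j \<le> 7"
  shows "skew_symmetric (so8 A i j)"
proof -
  have "transpose (cliff_conj A i ** cliff A j) = cliff_conj A j ** cliff A i"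
    using assms by (metis matrix_transpose_mul transpose_cliff transpose_transpose)
  moreover have "transpose (B - B') = transpose B - transpose B'" for B B' :: "real^8^8"
    by (simp add: transpose_def vec_eq_iff)
  moreover have "transpose (c *\<^sub>R B) = c *\<^sub>R transpose B" for B :: "real^8^8" and c
    by (simp add: transpose_def vec_eq_iff)
  ultimately have "transpose (so8 A i j) = so8 A j i"
    by (simp add: so8_def)
  then show ?thesis
    by (simp add: skew_symmetric_def so8_skew[OF assms])
qed

text \<open>Transposing one factor turns the inner product into a quadratic form of
  \<open>cliff_conj A j ** cliff A i\<close>. The Clifford relation then says that the inner product
  plus itself is \<open>2 * kdelta j i * (x \<bullet> x)\<close>.\<close>

lemma inner_cliff:
  assumes A: "clifford_family A" and le: "i \<le> 7" "j \<le> 7"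
  shows "(cliff A i *v x) \<bullet> (cliff A j *v x) = kdelta i j * (norm x)\<^sup>2"
proof -
  have *: "(cliff A a *v x) \<bullet> (cliff A b *v x) = ((cliff_conj A b ** cliff A a) *v x) \<bullet> x"
    if "a \<le> 7" "b \<le> 7" for a b
  proof -
    have "(cliff A a *v x) \<bullet> (cliff A b *v x) = ((cliff A a *v x) v* cliff A b) \<bullet> x"
      by (rule dot_lmul_matrix[symmetric])
    then show ?thesis
      by (simp add: matrix_vector_mul_assoc vector_transpose_matrix
          flip: transpose_cliff[OF A that(2)] transpose_matrix_vector)
  qed
  have "(cliff A i *v x) \<bullet> (cliff A j *v x) = 2 * kdelta j i * (x \<bullet> x) - (cliff A j *v x) \<bullet> (cliff A i *v x)"
    unfolding *[OF le] *[OF le(2,1)] cliff_conj_cliff[OF A le(2,1)]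
    by (simp add: matrix_vector_mult_diff_rdistrib inner_diff_left flip: scaleR_matrix_vector_assoc)
  then show ?thesis
    by (simp add: inner_commute dot_square_norm split: if_splits)
qed

text \<open>For \<open>x \<noteq> 0\<close> the vectors \<open>cliff A k *v x\<close> are an orthogonal basis of vectors of length \<open>norm x\<close>.\<close>

lemma sum_cliff_components:
  assumes A: "clifford_family A"
  shows "(\<Sum>k\<le>7. (cliff A k *v x) $ p * (cliff A k *v x) $ q) = (if p = q then (norm x)\<^sup>2 else 0)"
proof (cases "x = 0")
  case False
  define e where "e k = (cliff A k *v x) /\<^sub>R norm x" for k
  have e: "e i \<bullet> e j = kdelta i j" if "i \<le> 7" "j \<le> 7" for i j
    using False by (auto simp: e_def inner_cliff[OF A that] power2_eq_square field_simps)
  have inj: "inj_on e {..7}"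
    by (rule inj_onI) (metis atMost_iff e zero_neq_one)
  have orth: "pairwise orthogonal (e ` {..7})"
    using e by (force simp: pairwise_def orthogonal_def)
  have norm1: "norm y = 1" if "y \<in> e ` {..7}" for y
    using that e by (auto simp: norm_eq_1)
  have "independent (e ` {..7})"
    using norm1 by (intro pairwise_orthogonal_independent orth) force
  moreover have "card (e ` {..7}) = DIM(real^8)"
    by (simp add: card_image[OF inj])
  ultimately have "span (e ` {..7}) = UNIV"
    by (metis dim_eq_card_independent dim_eq_full)
  \<comment> \<open>Expanding a coordinate vector in the orthonormal basis and reading off its
    coordinate \<open>q\<close> passes from orthonormal columns to orthonormal rows.\<close>
  then have "(\<Sum>y\<in>e ` {..7}. (axis p 1 \<bullet> y) *\<^sub>R y) = axis p 1"
    by (intro orthonormal_basis_expand orth norm1) auto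
  then have "(\<Sum>k\<le>7. (e k $ p) *\<^sub>R e k) = axis p 1"
    by (simp add: sum.reindex[OF inj] inner_axis')
  then have "(\<Sum>k\<le>7. e k $ p * e k $ q) = axis p 1 $ q"
    by (simp add: vec_eq_iff)
  then have "(norm x)\<^sup>2 * (\<Sum>k\<le>7. e k $ p * e k $ q) = (if p = q then (norm x)\<^sup>2 else 0)"
    by (simp add: axis_def)
  then show ?thesis
    using False by (simp add: e_def sum_distrib_left power2_eq_square field_simps)
qed simp

subsection \<open>Casimir operators\<close>

text \<open>Summing over ordered pairs suits the index manipulations in
  \<open>sum_casimir_bracket\<close>. Every unordered pair counts twice and the diagonal contributes
  zero, hence the factors 1/2 and 2 later on.\<close>

definition casimir :: "(nat \<Rightarrow> real^8^8) \<Rightarrow> (real^8) set \<Rightarrow> nat set \<Rightarrow> (real^8 \<Rightarrow> real) \<Rightarrow> real^8 \<Rightarrow> real" where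
  "casimir A U I F x = (\<Sum>(i, j)\<in>I \<times> I. vf U (so8 A i j) (vf U (so8 A i j) F) x)"

lemma linear_op_casimir:
  assumes "open U" "finite I"
  shows "linear_op (smooth_functions U) (casimir A U I)"
proof -
  interpret function_space "smooth_functions U" by (rule function_space_smooth[OF assms(1)])
  show ?thesis
    unfolding casimir_def[abs_def] case_prod_unfold
    by (intro linear_op_sum linear_op_comp[OF linear_op_vf linear_op_vf])
      (use assms in auto)
qed

text \<open>For indices inside \<open>I\<close> this is the invariance of the Casimir operator under
  its own Lie algebra; for indices outside \<open>I\<close> all brackets vanish.\<close>

lemma commuting_so8_casimir:
  assumes A: "clifford_family A" and U: "open U" and I: "I \<subseteq> {..7}"
    and kl: "k \<le> 7" "l \<le> 7" "k \<in> I \<longleftrightarrow> l \<in> I"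
  shows "commuting (smooth_functions U) (vf U (so8 A k l)) (casimir A U I)"
proof -
  have fin: "finite I" using I finite_subset by blast
  have "(\<Sum>(i, j)\<in>I \<times> I. vf U (so8 A i j ** so8 A k l - so8 A k l ** so8 A i j) (vf U (so8 A i j) F) x
            + vf U (so8 A i j) (vf U (so8 A i j ** so8 A k l - so8 A k l ** so8 A i j) F) x) = 0"
    if F: "F \<in> smooth_functions U" for F x
  proof (rule sum_casimir_bracket[where S = "\<lambda>C E. vf U C (vf U E F) x + vf U E (vf U C F) x"
        and B = "so8 A" and k = k and l = l])
    show "linear (\<lambda>C. vf U C (vf U E F) x + vf U E (vf U C F) x)" for E
      by (rule linear_anticommutator[OF U F])
    show "so8 A j i = - so8 A i j" if "i \<in> insert k (insert l I)" "j \<in> insert k (insert l I)" for i j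
      using that I kl by (intro so8_skew[OF A]) auto
    show "so8 A i j ** so8 A k l - so8 A k l ** so8 A i j =
        (if j = k then 2 else 0) *\<^sub>R so8 A i l - (if i = k then 2 else 0) *\<^sub>R so8 A j l
      + (if i = l then 2 else 0) *\<^sub>R so8 A j k - (if j = l then 2 else 0) *\<^sub>R so8 A i k"
      if "i \<in> I" "j \<in> I" for i j
      using that I kl by (intro so8_Lie_bracket[OF A]) auto
  qed (use fin kl in auto)
  then show ?thesis
    unfolding casimir_def[abs_def] case_prod_unfold
    by (intro commuting_vf_sum_squares[OF U]) (use fin in auto)
qed

text \<open>If \<open>I\<close> lies in \<open>J\<close> or is disjoint from it, any two indices
  from \<open>I\<close> are both inside or both outside \<open>J\<close>. So every field whose
  square enters the operator of \<open>I\<close> already commutes with that of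
  \<open>J\<close>.\<close>

lemma commuting_casimir:
  assumes A: "clifford_family A" and U: "open U" and IJ: "I \<subseteq> {..7}" "J \<subseteq> {..7}"
    and nested: "I \<subseteq> J \<or> J \<subseteq> I \<or> I \<inter> J = {}"
  shows "commuting (smooth_functions U) (casimir A U I) (casimir A U J)"
proof -
  interpret function_space "smooth_functions U" by (rule function_space_smooth[OF U])
  have *: "commuting (smooth_functions U) (casimir A U J) (casimir A U I)"
    if "I \<subseteq> {..7}" "J \<subseteq> {..7}" "I \<subseteq> J \<or> I \<inter> J = {}" for I J
  proof -
    have fin: "finite I" "finite J" using that finite_subset by blast+
    have "commuting (smooth_functions U) (casimir A U J) (vf U (so8 A i j))" if "i \<in> I" "j \<in> I" for i j
      using \<open>I \<subseteq> {..7}\<close> \<open>J \<subseteq> {..7}\<close> \<open>I \<subseteq> J \<or> I \<inter> J = {}\<close> that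
      by (intro commuting_sym[OF commuting_so8_casimir[OF A U]]) auto
    then show ?thesis
      unfolding casimir_def[of A U I, abs_def] case_prod_unfold
      by (intro commuting_sum linear_op_casimir linear_op_comp[OF linear_op_vf linear_op_vf]
          commuting_comp[OF linear_op_vf linear_op_vf] U) (use fin in auto)
  qed
  show ?thesis
    using nested
  proof (elim disjE)
    assume "I \<subseteq> J"
    then show ?thesis by (intro commuting_sym[OF *[OF IJ]] disjI1)
  next
    assume "J \<subseteq> I"
    then show ?thesis by (intro *[OF IJ(2,1)] disjI1)
  next
    assume "I \<inter> J = {}"
    then show ?thesis by (intro commuting_sym[OF *[OF IJ]] disjI2)
  qed
qed

section \<open>Casimir operators as sums over unordered pairs, and the full Casimir operator\<close>

lemma so8_0: "1 \<le> j \<Longrightarrow> so8 A 0 j = A j"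
  by (simp add: so8_def cliff_def cliff_conj_def)

lemma so8_pos: "1 \<le> i \<Longrightarrow> 1 \<le> j \<Longrightarrow> i \<noteq> j \<Longrightarrow> so8 A i j = - (A i ** A j)"
  by (simp add: so8_def cliff_def cliff_conj_def matrix_mult_minus_left)

lemma vf_zero: "vf U 0 F = (\<lambda>x. 0)"
  by (auto simp: vf_def linear_vf_def)

lemma vf_square_so8_swap:
  assumes "clifford_family A" "open U" "F \<in> smooth_functions U" "i \<le> 7" "j \<le> 7"
  shows "vf U (so8 A j i) (vf U (so8 A j i) F) = vf U (so8 A i j) (vf U (so8 A i j) F)"
  unfolding so8_skew[OF assms(1,4,5)] by (rule vf_square_minus[OF assms(2,3)])

text \<open>With \<open>a = 0\<close> the new terms are the squares of the fields of
  \<open>A j\<close>, which is how these single matrices are split off from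
  \<open>{0, 6, 7}\<close>.\<close>

lemma casimir_insert:
  assumes A: "clifford_family A" and U: "open U" and F: "F \<in> smooth_functions U"
    and I: "finite I" "I \<subseteq> {..7}" "a \<le> 7" "a \<notin> I"
  shows "casimir A U (insert a I) F x =
    casimir A U I F x + 2 * (\<Sum>j\<in>I. vf U (so8 A a j) (vf U (so8 A a j) F) x)"
proof -
  let ?q = "\<lambda>i j. vf U (so8 A i j) (vf U (so8 A i j) F) x"
  have "casimir A U (insert a I) F x = (\<Sum>i\<in>insert a I. \<Sum>j\<in>insert a I. ?q i j)"
    by (simp add: casimir_def sum.cartesian_product)
  also have "\<dots> = ?q a a + (\<Sum>j\<in>I. ?q a j) + ((\<Sum>i\<in>I. ?q i a) + (\<Sum>i\<in>I. \<Sum>j\<in>I. ?q i j))"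
    using I by (simp add: sum.distrib)
  also have "?q a a = 0" using I by (simp add: so8_self[OF A] vf_zero)
  also have "(\<Sum>i\<in>I. ?q i a) = (\<Sum>j\<in>I. ?q a j)"
    using I vf_square_so8_swap[OF A U F I(3)] by (intro sum.cong) auto
  finally show ?thesis
    by (simp add: casimir_def sum.cartesian_product)
qed

lemma casimir_pairs:
  assumes A: "clifford_family A" and U: "open U" and F: "F \<in> smooth_functions U"
    and "finite I" "I \<subseteq> {..7}"
  shows "casimir A U I F x =
    2 * (\<Sum>(i, j)\<in>{(i, j). i \<in> I \<and> j \<in> I \<and> i < j}. vf U (so8 A i j) (vf U (so8 A i j) F) x)"
proof -
  let ?q = "\<lambda>(i, j). vf U (so8 A i j) (vf U (so8 A i j) F) x"
  let ?P = "{(i, j). i \<in> I \<and> j \<in> I \<and> i < j}" and ?P' = "{(i, j). i \<in> I \<and> j \<in> I \<and> j < i}"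
  have fin: "finite ?P" "finite ?P'" "finite (I \<times> I)"
    using assms(4) by (auto intro: finite_subset[of _ "I \<times> I"])
  have "casimir A U I F x = sum ?q (?P \<union> ?P')"
    unfolding casimir_def
  proof (rule sum.mono_neutral_right[OF fin(3)])
    have "I \<times> I - (?P \<union> ?P') \<subseteq> {(i, i) | i. i \<le> 7}"
      using assms(5) by (auto simp: not_less_iff_gr_or_eq)
    then show "\<forall>p\<in>I \<times> I - (?P \<union> ?P'). ?q p = 0"
      by (auto simp: so8_self[OF A] vf_zero)
  qed auto
  also have "\<dots> = sum ?q ?P + sum ?q ?P'"
    using fin by (intro sum.union_disjoint) auto
  also have "sum ?q ?P' = sum ?q ?P"
    by (rule sum.reindex_bij_witness[of _ prod.swap prod.swap])
       (use vf_square_so8_swap[OF A U F] assms(5) in auto)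
  finally show ?thesis by simp
qed

text \<open>The trace of the Hessian can be computed in any orthonormal basis;
  \<open>sum_cliff_components\<close> supplies one up to the length of \<open>y\<close>. The point
  \<open>x\<close> and the vector \<open>y\<close> are kept apart because
  \<open>casimir_full\<close> takes \<open>y = cliff A j *v x\<close>.\<close>

lemma sum_hess_cliff:
  assumes "clifford_family A"
  shows "(\<Sum>k\<le>7. hess F x (cliff A k *v y) (cliff A k *v y)) =
    (norm y)\<^sup>2 * (\<Sum>q\<in>UNIV. partial_deriv q (partial_deriv q F) x)"
proof -
  have "(\<Sum>k\<le>7. hess F x (cliff A k *v y) (cliff A k *v y)) =
    (\<Sum>p\<in>UNIV. \<Sum>q\<in>UNIV. (\<Sum>k\<le>7. (cliff A k *v y) $ p * (cliff A k *v y) $ q) *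
        partial_deriv q (partial_deriv p F) x)"
    unfolding hess_def sum_distrib_right
    by (subst sum.swap, rule sum.cong[OF refl], rule sum.swap)
  also have "\<dots> = (\<Sum>p\<in>UNIV. \<Sum>q\<in>UNIV. if p = q then (norm y)\<^sup>2 * partial_deriv q (partial_deriv p F) x else 0)"
    unfolding sum_cliff_components[OF assms] by (intro sum.cong) auto
  finally show ?thesis
    by (simp add: sum_distrib_left)
qed

lemma hess_minus: "hess F x (- u) (- u) = hess F x u u"
  by (simp add: hess_def)

lemma hess_cliff_conj: "hess F x (cliff_conj A k *v y) (cliff_conj A k *v y) = hess F x (cliff A k *v y) (cliff A k *v y)"
proof -
  have "(- B) *v y = - (B *v y)" for B :: "real^8^8"
    by (simp add: vec_eq_iff matrix_vector_mult_def sum_negf)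
  then show ?thesis by (simp add: cliff_def cliff_conj_def hess_minus)
qed

text \<open>Both sides have the same first order part, because \<open>E ** E = - mat 1\<close> for all 28 matrices
  involved, and both principal symbols are multiples of that of the Laplacian of the spheres
  around the origin.\<close>

lemma casimir_full:
  assumes A: "clifford_family A" and U: "open U" and F: "F \<in> smooth_functions U"
  shows "casimir A U {..7} F x = 8 * (\<Sum>k\<in>{1..7}. vf U (A k) (vf U (A k) F) x)"
proof (cases "x \<in> U")
  case True
  let ?h = "\<lambda>u. hess F x u u" and ?D = "linear_vf (mat 1) F x"
  let ?T = "\<Sum>q\<in>UNIV. partial_deriv q (partial_deriv q F) x"
  have lin_neg: "linear_vf (- mat 1) F x = - ?D"
    using linear_vf_linear[of "-1" "mat 1" 0 0 F x] by simp
  \<comment> \<open>On the diagonal the general expression would be \<open>- ?D + ?h x\<close>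
    instead of the true value 0. Subtracting it there permits sums over all index pairs.\<close>
  have sq: "vf U (so8 A i j) (vf U (so8 A i j) F) x =
      - ?D + ?h (cliff_conj A i *v (cliff A j *v x)) - (if i = j then - ?D + ?h x else 0)"
    if "i \<le> 7" "j \<le> 7" for i j
  proof (cases "i = j")
    case True
    then show ?thesis using that
      by (simp add: so8_self[OF A] vf_zero matrix_vector_mul_assoc cliff_conj_self[OF A])
  next
    case False
    then have "so8 A i j = cliff_conj A i ** cliff A j" by (simp add: so8_def)
    with False show ?thesis
      using vf_vf[OF U True F, of "so8 A i j" "so8 A i j"] so8_square[OF A that False]
      by (simp add: lin_neg matrix_vector_mul_assoc)
  qed
  have "(\<Sum>k\<in>{1..7}. vf U (A k) (vf U (A k) F) x) = (\<Sum>k\<in>{1..7}. - ?D + ?h (cliff A k *v x))"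
  proof (rule sum.cong[OF refl])
    fix k :: nat assume "k \<in> {1..7}"
    then show "vf U (A k) (vf U (A k) F) x = - ?D + ?h (cliff A k *v x)"
      using sq[of 0 k] by (simp add: so8_0 cliff_conj_def)
  qed
  \<comment> \<open>Adding and removing index 0 completes the orthogonal family for
    \<open>sum_hess_cliff\<close>.\<close>
  also have "\<dots> = - 7 * ?D + ((\<Sum>k\<le>7. ?h (cliff A k *v x)) - ?h (cliff A 0 *v x))"
  proof -
    have "{..7::nat} = insert 0 {1..7}" by auto
    then show ?thesis by (simp add: sum.distrib sum_subtractf)
  qed
  also have "\<dots> = - 7 * ?D + ((norm x)\<^sup>2 * ?T - ?h x)"
    by (simp add: sum_hess_cliff[OF A] cliff_def[of A 0])
  finally have rhs: "(\<Sum>k\<in>{1..7}. vf U (A k) (vf U (A k) F) x) = - 7 * ?D + ((norm x)\<^sup>2 * ?T - ?h x)" .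
  have norm_cliff: "(norm (cliff A j *v x))\<^sup>2 = (norm x)\<^sup>2" if "j \<le> 7" for j
    using inner_cliff[OF A that that] by (simp add: dot_square_norm)
  have "casimir A U {..7} F x = (\<Sum>j\<le>7. \<Sum>i\<le>7. vf U (so8 A i j) (vf U (so8 A i j) F) x)"
    unfolding casimir_def sum.cartesian_product[symmetric] by (rule sum.swap)
  also have "\<dots> = (\<Sum>j\<le>7. \<Sum>i\<le>7. - ?D + ?h (cliff A i *v (cliff A j *v x)) - (if i = j then - ?D + ?h x else 0))"
    by (intro sum.cong) (simp_all add: sq hess_cliff_conj)
  \<comment> \<open>For fixed \<open>j\<close> the sum over \<open>i\<close> is a full trace at the
    vector \<open>cliff A j *v x\<close>, which has the length of \<open>x\<close>. Each of the
    eight values of \<open>j\<close> thus contributes the value in \<open>rhs\<close>.\<close>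
  also have "\<dots> = (\<Sum>j\<le>(7::nat). - 8 * ?D + (norm x)\<^sup>2 * ?T - (- ?D + ?h x))"
    by (intro sum.cong refl) (simp add: sum.distrib sum_subtractf sum_hess_cliff[OF A] norm_cliff)
  finally show ?thesis
    unfolding rhs by simp
qed (simp add: casimir_def vf_def)

section \<open>Linear combinations of Casimir operators\<close>

inductive_set casimir_span :: "(nat \<Rightarrow> real^8^8) \<Rightarrow> (real^8) set \<Rightarrow> nat set set \<Rightarrow>
    ((real^8 \<Rightarrow> real) \<Rightarrow> real^8 \<Rightarrow> real) set"
  for A U L where
  casimir: "I \<in> L \<Longrightarrow> casimir A U I \<in> casimir_span A U L"
| add_scaled: "S \<in> casimir_span A U L \<Longrightarrow> T \<in> casimir_span A U L \<Longrightarrow>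
    (\<lambda>F x. a * S F x + b * T F x) \<in> casimir_span A U L"

lemma casimir_span_scaled:
  assumes "S \<in> casimir_span A U L"
  shows "(\<lambda>F x. a * S F x) \<in> casimir_span A U L"
  using casimir_span.add_scaled[OF assms assms, of a 0] by simp

lemma linear_op_casimir_span:
  assumes "open U" "\<And>I. I \<in> L \<Longrightarrow> finite I" "S \<in> casimir_span A U L"
  shows "linear_op (smooth_functions U) S"
proof -
  interpret function_space "smooth_functions U" by (rule function_space_smooth[OF assms(1)])
  show ?thesis
    using assms(3) by induction (auto intro: linear_op_casimir linear_op_add_scaled assms)
qed

text \<open>Commutation of the spanning operators extends bilinearly, by one induction for each
  argument.\<close>

lemma commuting_casimir_span:
  assumes A: "clifford_family A" and U: "open U"
    and L: "\<And>I. I \<in> L \<Longrightarrow> I \<subseteq> {..7}"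
      "\<And>I J. I \<in> L \<Longrightarrow> J \<in> L \<Longrightarrow> I \<subseteq> J \<or> J \<subseteq> I \<or> I \<inter> J = {}"
    and S: "S \<in> casimir_span A U L" and T: "T \<in> casimir_span A U L"
  shows "commuting (smooth_functions U) S T"
proof -
  interpret function_space "smooth_functions U" by (rule function_space_smooth[OF U])
  have fin: "finite I" if "I \<in> L" for I using L(1)[OF that] finite_subset by blast
  note lin = linear_op_casimir_span[OF U fin, where A = A]
  have *: "commuting (smooth_functions U) (casimir A U I) S"
    if "I \<in> L" "S \<in> casimir_span A U L" for I S
    using that(2)
  proof induction
    case (casimir J)
    with that(1) show ?case by (intro commuting_casimir[OF A U] L)
  qed (intro commuting_add_scaled lin linear_op_casimir[OF U fin] that(1))
  show ?thesis
    using T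
  proof induction
    case (casimir I)
    then show ?case by (intro commuting_sym[OF *] S)
  next
    case (add_scaled T T' a b)
    then show ?case using S by (simp add: commuting_add_scaled lin)
  qed
qed

subsection \<open>The generating sets\<close>

text \<open>Among eight indices some \<open>m\<close> avoids \<open>i\<close>, \<open>j\<close>,
  \<open>k\<close>, \<open>l\<close>. Then \<open>so8 A i m\<close> commutes with
  \<open>so8 A k l\<close>, but its bracket with \<open>so8 A i j\<close> is a nonzero multiple of
  \<open>so8 A j m\<close>, which cannot vanish because its square is
  \<open>- mat 1\<close>.\<close>

lemma so8_not_parallel:
  assumes A: "clifford_family A" and le: "i \<le> 7" "j \<le> 7" "k \<le> 7" "l \<le> 7"
    and ne: "i \<noteq> j" "i \<noteq> k" "i \<noteq> l"
  shows "so8 A i j \<noteq> c *\<^sub>R so8 A k l"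
proof
  assume eq: "so8 A i j = c *\<^sub>R so8 A k l"
  have "\<not> {..7} \<subseteq> set [i, j, k, l]"
    using card_mono[of "set [i, j, k, l]" "{..7}"] card_length[of "[i, j, k, l]"] by auto
  then obtain m where m: "m \<le> 7" "m \<notin> {i, j, k, l}"
    by auto
  have "so8 A k l ** so8 A i m - so8 A i m ** so8 A k l = 0"
    using so8_Lie_bracket[OF A le(3,4,1) m(1)] m ne by simp
  then have "so8 A i j ** so8 A i m - so8 A i m ** so8 A i j = 0"
    unfolding eq matrix_mult_bilinear by (simp flip: scaleR_diff_right)
  then have "so8 A j m = 0"
    using so8_Lie_bracket[OF A le(1,2,1) m(1)] m ne by (simp add: so8_self[OF A le(1)])
  moreover have "so8 A j m ** so8 A j m = - mat 1"
    using m by (intro so8_square[OF A] le) auto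
  ultimately have "mat 1 = (0 :: real^8^8)" by simp
  then have "(mat 1 :: real^8^8) $ 1 $ 1 = 0" by simp
  then show False by (simp add: mat_def)
qed

definition generator :: "(nat \<Rightarrow> real^8^8) \<Rightarrow> nat \<Rightarrow> nat \<Rightarrow> real^8^8" where
  "generator A i j = (if i = 0 then A j else A i ** A j)"

definition index_pairs :: "nat set \<Rightarrow> (nat \<times> nat) set" where
  "index_pairs I = {(i, j). i \<in> I \<and> j \<in> I \<and> i < j}"

lemma finite_index_pairs: "finite I \<Longrightarrow> finite (index_pairs I)"
  unfolding index_pairs_def by (rule finite_subset[of _ "I \<times> I"]) auto

lemma generator_so8:
  assumes "i < j"
  shows "generator A i j = (if i = 0 then 1 else - 1) *\<^sub>R so8 A i j"
  using assms by (auto simp: generator_def so8_0 so8_pos)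

text \<open>The operators sum over sets of matrices. Injectivity ensures that no two index pairs
  collapse, so these sums may be taken over pairs.\<close>

lemma inj_generator:
  assumes A: "clifford_family A"
  shows "inj_on (\<lambda>(i, j). generator A i j) (index_pairs {..7})"
proof (rule inj_onI)
  fix p q :: "nat \<times> nat"
  assume pq: "p \<in> index_pairs {..7}" "q \<in> index_pairs {..7}"
    and "(case p of (i, j) \<Rightarrow> generator A i j) = (case q of (i, j) \<Rightarrow> generator A i j)"
  moreover obtain i j k l where ijkl: "p = (i, j)" "q = (k, l)" by fastforce
  ultimately have le: "i \<le> 7" "j \<le> 7" "k \<le> 7" "l \<le> 7" and less: "i < j" "k < l"
    and eq: "generator A i j = generator A k l"
    by (auto simp: index_pairs_def)
  define s t where "s = (if i = 0 then 1 else - 1 :: real)" and "t = (if k = 0 then 1 else - 1 :: real)"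
  have "s *\<^sub>R so8 A i j = t *\<^sub>R so8 A k l"
    using eq less by (simp add: generator_so8 s_def t_def)
  then have "(s * s) *\<^sub>R so8 A i j = (s * t) *\<^sub>R so8 A k l"
    by (simp flip: scaleR_scaleR)
  then have ij: "so8 A i j = (s * t) *\<^sub>R so8 A k l"
    by (simp add: s_def split: if_splits)
  then have ji: "so8 A j i = (- (s * t)) *\<^sub>R so8 A k l"
    by (simp add: so8_skew[OF A le(1,2)])
  \<comment> \<open>\<open>so8_not_parallel\<close> restricts only the first index, so it is used
    for both orders of the pair.\<close>
  have "i \<in> {k, l}" "j \<in> {k, l}"
    using so8_not_parallel[OF A le(1,2,3,4), of "s * t"] ij
      so8_not_parallel[OF A le(2,1,3,4), of "- (s * t)"] ji less by blast+
  then show "p = q" using less ijkl by auto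
qed

lemma generator_square:
  assumes "open U" "F \<in> smooth_functions U" "i < j"
  shows "vf U (generator A i j) (vf U (generator A i j) F) = vf U (so8 A i j) (vf U (so8 A i j) F)"
  using generator_so8[OF assms(3), of A] vf_square_minus[OF assms(1,2)] by (simp split: if_splits)

lemma sum_generators:
  assumes A: "clifford_family A" and U: "open U" and F: "F \<in> smooth_functions U" and I: "I \<subseteq> {..7}"
  shows "(\<Sum>E\<in>(\<lambda>(i, j). generator A i j) ` index_pairs I. vf U E (vf U E F) x) = 1/2 * casimir A U I F x"
proof -
  have "inj_on (\<lambda>(i, j). generator A i j) (index_pairs I)"
    using inj_generator[OF A] by (rule inj_on_subset) (use I in \<open>auto simp: index_pairs_def\<close>)
  then have "(\<Sum>E\<in>(\<lambda>(i, j). generator A i j) ` index_pairs I. vf U E (vf U E F) x) =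
      (\<Sum>(i, j)\<in>index_pairs I. vf U (so8 A i j) (vf U (so8 A i j) F) x)"
    by (simp add: sum.reindex)
       (intro sum.cong, auto simp: index_pairs_def generator_square[OF U F])
  then show ?thesis
    using casimir_pairs[OF A U F _ I] finite_subset[OF I] by (simp add: index_pairs_def)
qed

lemma sum_generators_Un:
  assumes A: "clifford_family A" and U: "open U" and F: "F \<in> smooth_functions U"
    and I: "I \<subseteq> {..7}" "J \<subseteq> {..7}" "I \<inter> J = {}"
  shows "(\<Sum>E\<in>(\<lambda>(i, j). generator A i j) ` (index_pairs I \<union> index_pairs J). vf U E (vf U E F) x) =
    1/2 * casimir A U I F x + 1/2 * casimir A U J F x"
proof -
  let ?g = "\<lambda>(i, j). generator A i j"
  have "?g ` index_pairs I \<inter> ?g ` index_pairs J = ?g ` (index_pairs I \<inter> index_pairs J)"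
    by (rule inj_on_image_Int[OF inj_generator[OF A], symmetric])
       (use I in \<open>auto simp: index_pairs_def\<close>)
  also have "index_pairs I \<inter> index_pairs J = {}"
    using I(3) by (auto simp: index_pairs_def)
  finally have disj: "?g ` index_pairs I \<inter> ?g ` index_pairs J = {}" by simp
  show ?thesis
    unfolding image_Un
    by (subst sum.union_disjoint)
       (use disj I in \<open>auto simp: sum_generators[OF A U F] intro!: finite_index_pairs intro: finite_subset\<close>)
qed

text \<open>Reading \<open>A k\<close> as the pair \<open>(0, k)\<close> makes each generating set a
  union of complete pair sets; in particular \<open>A 6\<close>, \<open>A 7\<close> and
  \<open>A 6 ** A 7\<close> are the pairs from \<open>{0, 6, 7}\<close>.\<close>

lemma generating_set_image:
  assumes "1 \<le> l" "l \<le> 7"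
  shows "generating_set A l = (\<lambda>(i, j). generator A i j) `
    (if l \<le> 4 then index_pairs {1..l + 1}
     else if l = 5 then index_pairs {1..5} \<union> index_pairs {6, 7}
     else if l = 6 then index_pairs {1..5} \<union> index_pairs {0, 6, 7}
     else index_pairs {..7})"
proof -
  let ?g = "\<lambda>(i, j). generator A i j"
  have n: "?g ` index_pairs {1..n} = {A i ** A j | i j. 1 \<le> i \<and> i < j \<and> j \<le> n}" for n
  proof (intro equalityI subsetI)
    fix E assume "E \<in> {A i ** A j | i j. 1 \<le> i \<and> i < j \<and> j \<le> n}"
    then obtain i j where "E = A i ** A j" "1 \<le> i" "i < j" "j \<le> n" by blast
    then show "E \<in> ?g ` index_pairs {1..n}"
      by (intro image_eqI[of _ _ "(i, j)"]) (auto simp: index_pairs_def generator_def)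
  next
    fix E assume "E \<in> ?g ` index_pairs {1..n}"
    then obtain i j where "E = generator A i j" "1 \<le> i" "i < j" "j \<le> n"
      by (auto simp: index_pairs_def)
    then show "E \<in> {A i ** A j | i j. 1 \<le> i \<and> i < j \<and> j \<le> n}"
      by (auto simp: generator_def)
  qed
  have "index_pairs {6, 7} = {(6, 7)}" "index_pairs {0, 6, 7} = {(6, 7), (0, 6), (0, 7)}"
    by (auto simp: index_pairs_def)
  then have m: "?g ` index_pairs {6, 7} = {A 6 ** A 7}"
      "?g ` index_pairs {0, 6, 7} = {A 6 ** A 7} \<union> {A 6, A 7}"
    by (auto simp: generator_def)
  have "index_pairs {..7} = index_pairs {1..7} \<union> (\<lambda>k. (0, k)) ` {1..7}"
    by (auto simp: index_pairs_def image_iff)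
  then have f: "?g ` index_pairs {..7} =
      {A i ** A j | i j. 1 \<le> i \<and> i < j \<and> j \<le> 7} \<union> {A k | k. 1 \<le> k \<and> k \<le> 7}"
    by (simp only: image_Un n image_image) (auto simp: generator_def)
  have G5: "{A i ** A j | i j. (1 \<le> i \<and> i < j \<and> j \<le> 5) \<or> (i, j) = (6, 7)} =
      {A i ** A j | i j. 1 \<le> i \<and> i < j \<and> j \<le> 5} \<union> {A 6 ** A 7}"
    by auto
  show ?thesis
    using assms unfolding generating_set_def Let_def G5
    by (simp add: image_Un n[unfolded One_nat_def] n m f Un_assoc)
qed

section \<open>The given operators as Casimir combinations for one laminar family\<close>

definition laminar :: "nat set set" where
  "laminar = {{1..n} | n. n \<le> 5} \<union> {{6, 7}, {0, 6, 7}, {..7}}"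

lemma laminar_mem:
  "n \<le> 5 \<Longrightarrow> {1..n} \<in> laminar" "{6, 7} \<in> laminar" "{0, 6, 7} \<in> laminar" "{..7} \<in> laminar"
  by (auto simp: laminar_def)

lemma laminar_subset: "I \<in> laminar \<Longrightarrow> I \<subseteq> {..7}"
  by (auto simp: laminar_def)

text \<open>The segments start at 1 and stop at 5 or earlier, so they form a chain and miss 0, 6 and
  7. The sets \<open>{6, 7}\<close> and \<open>{0, 6, 7}\<close> form a second chain, and
  \<open>{..7}\<close> contains everything.\<close>

lemma laminar_nested:
  assumes "I \<in> laminar" "J \<in> laminar"
  shows "I \<subseteq> J \<or> J \<subseteq> I \<or> I \<inter> J = {}"
proof -
  define seg where "seg K \<longleftrightarrow> (\<exists>n\<le>5. K = {1..n})" for K :: "nat set"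
  define tail where "tail K \<longleftrightarrow> K = {6, 7} \<or> K = {0, 6, 7}" for K :: "nat set"
  have "K = {..7} \<or> seg K \<or> tail K" if "K \<in> laminar" for K
    using that by (auto simp: laminar_def seg_def tail_def)
  then consider "I = {..7} \<or> J = {..7}" | "seg I" "seg J" | "tail I" "tail J"
    | "seg I" "tail J" | "tail I" "seg J"
    using assms by meson
  then show ?thesis
  proof cases
    case 1
    then show ?thesis using laminar_subset assms by metis
  next
    case 2
    then obtain m n where "I = {1..m}" "J = {1..n}" by (auto simp: seg_def)
    then show ?thesis using linear[of m n] by auto
  next
    case 3
    then show ?thesis by (auto simp: tail_def)
  next
    case 4
    then have "I \<inter> J = {}" by (auto simp: seg_def tail_def)
    then show ?thesis by simp
  next
    case 5
    then have "I \<inter> J = {}" by (auto simp: seg_def tail_def)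
    then show ?thesis by simp
  qed
qed

lemma generators_casimir_span:
  assumes A: "clifford_family A" and U: "open U" and l: "l \<in> {1..7}"
  obtains S where "S \<in> casimir_span A U laminar"
    "\<And>F. F \<in> smooth_functions U \<Longrightarrow> S F = (\<lambda>x. \<Sum>E\<in>generating_set A l. vf U E (vf U E F) x)"
proof -
  note gen = generating_set_image[of l A]
  note cs = casimir_span.casimir[where A = A and U = U, OF laminar_mem(1)]
    casimir_span.casimir[where A = A and U = U, OF laminar_mem(2)]
    casimir_span.casimir[where A = A and U = U, OF laminar_mem(3)]
    casimir_span.casimir[where A = A and U = U, OF laminar_mem(4)]
  consider "l \<le> 4" | "l = 5" | "l = 6" | "l = 7" using l by force
  then show ?thesis
  proof cases
    case 1
    show ?thesis
      by (rule that[OF casimir_span_scaled[OF cs(1)[of "l + 1"], of "1/2"]])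
         (use 1 l gen sum_generators[OF A U, of _ "{1..l + 1}"] in auto)
  next
    case 2
    show ?thesis
      by (rule that[OF casimir_span.add_scaled[OF cs(1)[of 5] cs(2), of "1/2" "1/2"]])
         (use 2 gen sum_generators_Un[OF A U, of _ "{1..5}" "{6, 7}"] in auto)
  next
    case 3
    show ?thesis
      by (rule that[OF casimir_span.add_scaled[OF cs(1)[of 5] cs(3), of "1/2" "1/2"]])
         (use 3 gen sum_generators_Un[OF A U, of _ "{1..5}" "{0, 6, 7}"] in auto)
  next
    case 4
    show ?thesis
      by (rule that[OF casimir_span_scaled[OF cs(4), of "1/2"]])
         (use 4 gen sum_generators[OF A U, of _ "{..7}"] in auto)
  qed
qed

lemma sublaplacian_casimir_span:
  assumes A: "clifford_family A" and U: "open U"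
  obtains S where "S \<in> casimir_span A U laminar"
    "\<And>F. F \<in> smooth_functions U \<Longrightarrow> S F = (\<lambda>x. - (\<Sum>j\<in>{1..5}. vf U (A j) (vf U (A j) F) x))"
proof -
  \<comment> \<open>By \<open>casimir_full\<close> the first term is minus the sum of all seven
    squares. By \<open>casimir_insert\<close> half the difference of the other two restores those of
    \<open>A 6\<close> and \<open>A 7\<close>. The factor \<open>1 *\<close> fits the rule
    \<open>add_scaled\<close>.\<close>
  define S where "S F x = - 1/8 * casimir A U {..7} F x
      + 1 * (1/2 * casimir A U {0, 6, 7} F x + - 1/2 * casimir A U {6, 7} F x)" for F x
  have "S \<in> casimir_span A U laminar"
    unfolding S_def[abs_def] by (intro casimir_span.intros laminar_mem)
  moreover have "S F x = - (\<Sum>j\<in>{1..5}. vf U (A j) (vf U (A j) F) x)"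
    if F: "F \<in> smooth_functions U" for F x
  proof -
    have "{1..7::nat} = {1..5} \<union> {6, 7}" by auto
    then have "(\<Sum>k\<in>{1..7}. vf U (A k) (vf U (A k) F) x) =
      (\<Sum>k\<in>{1..5}. vf U (A k) (vf U (A k) F) x) + (\<Sum>k\<in>{6, 7}. vf U (A k) (vf U (A k) F) x)"
      by (simp only:) (intro sum.union_disjoint; auto)
    moreover have "casimir A U {0, 6, 7} F x = casimir A U {6, 7} F x
        + 2 * (\<Sum>k\<in>{6, 7}. vf U (A k) (vf U (A k) F) x)"
      using casimir_insert[OF A U F, of "{6, 7}" 0 x] by (simp add: so8_0)
    moreover have "- 1/8 * (8 * a) + 1 * (1/2 * d + - 1/2 * e) = - b"
      if "a = b + c" "d = e + 2 * c" for a b c d e :: real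
      using that by (simp add: field_simps)
    ultimately show ?thesis
      unfolding S_def casimir_full[OF A U F] by blast
  qed
  ultimately show ?thesis by (intro that[of S] ext)
qed

lemma skew_symmetric_generating_set:
  assumes A: "clifford_family A" and "l \<in> {1..7}" "E \<in> generating_set A l"
  shows "skew_symmetric E"
proof -
  have "generating_set A l \<subseteq> (\<lambda>(i, j). generator A i j) ` index_pairs {..7}"
    using assms(2) by (subst generating_set_image) (auto intro!: image_mono simp: index_pairs_def)
  then obtain i j where ij: "i < j" "j \<le> 7" "E = generator A i j"
    using assms(3) by (auto simp: index_pairs_def)
  then have "skew_symmetric (so8 A i j)" by (intro skew_symmetric_so8[OF A]) auto
  moreover have "transpose (- B) = - transpose B" for B :: "real^8^8"
    by (simp add: transpose_def vec_eq_iff)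
  ultimately show ?thesis
    using generator_so8[OF ij(1), of A] ij(3) by (auto simp: skew_symmetric_def)
qed

subsection \<open>Restriction to the sphere\<close>

lemma vf_sphere:
  assumes U: "unit_sphere \<subseteq> U" and F: "F \<in> smooth_functions U" and E: "skew_symmetric E"
    and eq: "\<And>x. x \<in> unit_sphere \<Longrightarrow> F x = f x" and x: "x \<in> unit_sphere"
  shows "vf U E F x = sphere_vf E f x"
  using sphere_vf_extension[OF E x smooth_functions_differentiable[OF F] eq] U x
  by (auto simp: vf_def)

text \<open>After one application \<open>vf U E F\<close> is again smooth on \<open>U\<close> and
  extends \<open>sphere_vf E f\<close> from the sphere, so \<open>vf_sphere\<close> applies a second
  time.\<close>

lemma vf_vf_sphere:
  assumes "open U" "unit_sphere \<subseteq> U" "F \<in> smooth_functions U" "skew_symmetric E"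
    and eq: "\<And>x. x \<in> unit_sphere \<Longrightarrow> F x = f x" and x: "x \<in> unit_sphere"
  shows "vf U E (vf U E F) x = sphere_vf E (sphere_vf E f) x"
  using assms by (intro vf_sphere linear_op_closed[OF linear_op_vf]) auto

lemma smooth_on_sphere_extension:
  assumes "smooth_on_sphere f"
  obtains U F where "open U" "unit_sphere \<subseteq> U" "F \<in> smooth_functions U"
    "\<And>x. x \<in> unit_sphere \<Longrightarrow> F x = f x"
proof -
  obtain U G where G: "unit_sphere \<subseteq> U" "open U" "\<And>k. Ck_on k U G" "\<And>x. x \<in> unit_sphere \<Longrightarrow> G x = f x"
    using assms unfolding smooth_on_sphere_def smooth_on_open_def by blast
  let ?F = "\<lambda>x. if x \<in> U then G x else 0"
  have "Ck_on k U ?F" for k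
    by (rule Ck_on_cong[OF G(2), THEN iffD2, OF _ G(3)]) simp
  then have "?F \<in> smooth_functions U" by (simp add: smooth_functions_def)
  then show ?thesis
    by (rule that[OF G(2,1)]) (use G in auto)
qed

text \<open>Allowing every \<open>f\<close> that agrees with \<open>F\<close> on the sphere lets
  representations be composed: \<open>T F\<close> and \<open>Q f\<close> agree there but may differ
  elsewhere.\<close>

definition represents_on_sphere :: "(real^'n::finite) set \<Rightarrow>
    ((real^'n \<Rightarrow> real) \<Rightarrow> real^'n \<Rightarrow> real) \<Rightarrow>
    ((real^'n \<Rightarrow> real) \<Rightarrow> real^'n \<Rightarrow> real) \<Rightarrow> bool" where
  "represents_on_sphere U S P \<longleftrightarrow>
     (\<forall>F f. F \<in> smooth_functions U \<longrightarrow> (\<forall>x\<in>unit_sphere. F x = f x) \<longrightarrow>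
       (\<forall>x\<in>unit_sphere. S F x = P f x))"

lemma represents_on_sphereD:
  assumes "represents_on_sphere U S P" "F \<in> smooth_functions U"
    "\<And>x. x \<in> unit_sphere \<Longrightarrow> F x = f x" "x \<in> unit_sphere"
  shows "S F x = P f x"
  using assms unfolding represents_on_sphere_def by blast

text \<open>The neighbourhood on which \<open>f\<close> extends smoothly depends on
  \<open>f\<close>, so commuting representatives are required for every \<open>U\<close>.\<close>

lemma commute_on_sphereI:
  fixes P Q :: "(real^'n::finite \<Rightarrow> real) \<Rightarrow> real^'n \<Rightarrow> real"
  assumes "\<And>U. open U \<Longrightarrow> unit_sphere \<subseteq> U \<Longrightarrow>
      \<exists>S T. linear_op (smooth_functions U) S \<and> linear_op (smooth_functions U) T \<and>
        commuting (smooth_functions U) S T \<and>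
        represents_on_sphere U S P \<and> represents_on_sphere U T Q"
  shows "commute_on_sphere P Q"
  unfolding commute_on_sphere_def
proof (intro allI impI ballI)
  fix f :: "real^'n \<Rightarrow> real" and x :: "real^'n"
  assume f: "smooth_on_sphere f" and x: "x \<in> unit_sphere"
  obtain U F where U: "open U" "unit_sphere \<subseteq> U" and F: "F \<in> smooth_functions U"
    and Ff: "\<And>x. x \<in> unit_sphere \<Longrightarrow> F x = f x"
    using smooth_on_sphere_extension[OF f] by blast
  obtain S T where S: "linear_op (smooth_functions U) S" "represents_on_sphere U S P"
    and T: "linear_op (smooth_functions U) T" "represents_on_sphere U T Q"
    and ST: "commuting (smooth_functions U) S T"
    using assms[OF U] by blast
  have "P (Q f) x = S (T F) x"
    by (rule represents_on_sphereD[OF S(2) linear_op_closed[OF T(1) F], symmetric])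
      (simp_all only: represents_on_sphereD[OF T(2) F Ff] x)
  also have "\<dots> = T (S F) x"
    using ST F by (simp add: commuting_def)
  also have "\<dots> = Q (P f) x"
    by (rule represents_on_sphereD[OF T(2) linear_op_closed[OF S(1) F]])
      (simp_all only: represents_on_sphereD[OF S(2) F Ff] x)
  finally show "P (Q f) x = Q (P f) x" .
qed

theorem proposition6p1:
  fixes A :: "nat \<Rightarrow> real^8^8"
  assumes "clifford_family A"
  shows "(\<forall>l\<in>{1..7}. \<forall>m\<in>{1..7}. commute_on_sphere (op_G A l) (op_G A m)) \<and>
         (\<forall>l\<in>{1..7}. commute_on_sphere (op_G A l) (sublaplacian_T5 A))"
proof -
  \<comment> \<open>All operators in question share this property, with the same laminar family, and
    any two operators having it commute. One argument thus covers both claims.\<close>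
  define rep where "rep P \<longleftrightarrow> (\<forall>U. open U \<longrightarrow> unit_sphere \<subseteq> U \<longrightarrow>
      (\<exists>S\<in>casimir_span A U laminar. represents_on_sphere U S P))" for P
  have comm: "commute_on_sphere P Q" if P: "rep P" and Q: "rep Q" for P Q
  proof (rule commute_on_sphereI)
    fix U :: "(real^8) set" assume U: "open U" "unit_sphere \<subseteq> U"
    obtain S T where ST: "S \<in> casimir_span A U laminar" "T \<in> casimir_span A U laminar"
      and r: "represents_on_sphere U S P" "represents_on_sphere U T Q"
      using P Q U unfolding rep_def by meson
    have fin: "finite I" if "I \<in> laminar" for I
      using laminar_subset[OF that] finite_subset by blast
    show "\<exists>S T. linear_op (smooth_functions U) S \<and> linear_op (smooth_functions U) T \<and>
        commuting (smooth_functions U) S T \<and>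
        represents_on_sphere U S P \<and> represents_on_sphere U T Q"
      by (rule exI[of _ S], rule exI[of _ T])
        (intro conjI r linear_op_casimir_span[OF U(1) fin ST(1)]
          linear_op_casimir_span[OF U(1) fin ST(2)]
          commuting_casimir_span[OF assms U(1) laminar_subset laminar_nested ST])
  qed
  have G: "rep (op_G A l)" if l: "l \<in> {1..7}" for l
    unfolding rep_def
  proof (intro allI impI)
    fix U :: "(real^8) set" assume U: "open U" "unit_sphere \<subseteq> U"
    obtain S where S: "S \<in> casimir_span A U laminar"
      "\<And>F. F \<in> smooth_functions U \<Longrightarrow> S F = (\<lambda>x. \<Sum>E\<in>generating_set A l. vf U E (vf U E F) x)"
      using generators_casimir_span[OF assms U(1) l] by blast
    have "S F x = op_G A l f x"
      if "F \<in> smooth_functions U" "\<forall>x\<in>unit_sphere. F x = f x" "x \<in> unit_sphere" for F f x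
      unfolding S(2)[OF that(1)] op_G_def using that
      by (intro sum.cong refl vf_vf_sphere[OF U] skew_symmetric_generating_set[OF assms l]) auto
    then have "represents_on_sphere U S (op_G A l)"
      unfolding represents_on_sphere_def by blast
    with S(1) show "\<exists>S\<in>casimir_span A U laminar. represents_on_sphere U S (op_G A l)" by blast
  qed
  have D: "rep (sublaplacian_T5 A)"
    unfolding rep_def
  proof (intro allI impI)
    fix U :: "(real^8) set" assume U: "open U" "unit_sphere \<subseteq> U"
    obtain S where S: "S \<in> casimir_span A U laminar"
      "\<And>F. F \<in> smooth_functions U \<Longrightarrow> S F = (\<lambda>x. - (\<Sum>j\<in>{1..5}. vf U (A j) (vf U (A j) F) x))"
      using sublaplacian_casimir_span[OF assms U(1)] by blast
    have skew: "skew_symmetric (A j)" if "j \<in> {1..5}" for j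
      using assms that by (simp add: clifford_family_def)
    have "S F x = sublaplacian_T5 A f x"
      if "F \<in> smooth_functions U" "\<forall>x\<in>unit_sphere. F x = f x" "x \<in> unit_sphere" for F f x
      unfolding S(2)[OF that(1)] sublaplacian_T5_def using that
      by (intro arg_cong[of _ _ uminus] sum.cong refl vf_vf_sphere[OF U] skew) auto
    then have "represents_on_sphere U S (sublaplacian_T5 A)"
      unfolding represents_on_sphere_def by blast
    with S(1) show "\<exists>S\<in>casimir_span A U laminar. represents_on_sphere U S (sublaplacian_T5 A)" by blast
  qed
  show ?thesis
    by (intro conjI ballI comm G D)
qed

end
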